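(* Every strongly polynomial sequence of finite graphs $(G_n)_{n\in\mathbb N}$ converges to a random-free graphon.
   Context: Graphs are viewed as relational structures with a single symmetric irreflexive binary relation. For a first-order formula $\phi$ in the language of graphs (with equality) with exactly $p$ free variables, $\phi(G)=\{(v_1,\dots,v_p)\in V(G)^p: G\models\phi(v_1,\dots,v_p)\}$. A sequence $(G_n)_{n\in\mathbb N}$ is strongly polynomial if for every quantifier-free formula $\phi$ there is a polynomial $P_\phi$ with $|\phi(G_n)|=P_\phi(n)$ for all $n\in\mathbb N$. A graphon is a symmetric measurable function $W:[0,1]^2\to[0,1]$; for a graph $F$ on vertex set $\{1,\dots,m\}$, $t(F,W)=\int_{[0,1]^m}\prod_{ij\in E(F)}W(x_i,x_j)\,dx$, and for a finite graph $G$, $t(F,G)={\rm hom}(F,G)/|V(G)|^{m}$ (the probability that a uniformly random map $V(F)\to V(G)$ is a homomorphism). A sequence $(G_n)$ converges to $W$ if $t(F,G_n)\to t(F,W)$ for every finite graph $F$. A graphon is random-free if it takes values in $\{0,1\}$ almost everywhere. *)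

theory Defs
  imports "HOL-Probability.Probability" "Graph_Theory.Pair_Digraph"
    "HOL-Computational_Algebra.Polynomial"
begin

(* A finite graph is a pair_graph: its arc set is a symmetric irreflexive relation on its
   finite vertex set, so that every edge uv is present as the two arcs (u,v) and (v,u). *)

section \<open>First-order formulas in the language of graphs\<close>

datatype fo_formula =
    Equal nat nat
  | Adjacent nat nat
  | Neg fo_formula
  | Conj fo_formula fo_formula
  | Disj fo_formula fo_formula
  | Forall nat fo_formula
  | Exists nat fo_formula

primrec free_vars :: "fo_formula \<Rightarrow> nat set" where
  "free_vars (Equal i j) = {i, j}"
| "free_vars (Adjacent i j) = {i, j}"
| "free_vars (Neg \<phi>) = free_vars \<phi>"
| "free_vars (Conj \<phi> \<psi>) = free_vars \<phi> \<union> free_vars \<psi>"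
| "free_vars (Disj \<phi> \<psi>) = free_vars \<phi> \<union> free_vars \<psi>"
| "free_vars (Forall i \<phi>) = free_vars \<phi> - {i}"
| "free_vars (Exists i \<phi>) = free_vars \<phi> - {i}"

primrec quantifier_free :: "fo_formula \<Rightarrow> bool" where
  "quantifier_free (Equal i j) = True"
| "quantifier_free (Adjacent i j) = True"
| "quantifier_free (Neg \<phi>) = quantifier_free \<phi>"
| "quantifier_free (Conj \<phi> \<psi>) = (quantifier_free \<phi> \<and> quantifier_free \<psi>)"
| "quantifier_free (Disj \<phi> \<psi>) = (quantifier_free \<phi> \<and> quantifier_free \<psi>)"
| "quantifier_free (Forall i \<phi>) = False"
| "quantifier_free (Exists i \<phi>) = False"

primrec satisfies :: "'a pair_pre_digraph \<Rightarrow> fo_formula \<Rightarrow> (nat \<Rightarrow> 'a) \<Rightarrow> bool" where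
  "satisfies G (Equal i j) v = (v i = v j)"
| "satisfies G (Adjacent i j) v = ((v i, v j) \<in> parcs G)"
| "satisfies G (Neg \<phi>) v = (\<not> satisfies G \<phi> v)"
| "satisfies G (Conj \<phi> \<psi>) v = (satisfies G \<phi> v \<and> satisfies G \<psi> v)"
| "satisfies G (Disj \<phi> \<psi>) v = (satisfies G \<phi> v \<or> satisfies G \<psi> v)"
| "satisfies G (Forall i \<phi>) v = (\<forall>a\<in>pverts G. satisfies G \<phi> (v(i := a)))"
| "satisfies G (Exists i \<phi>) v = (\<exists>a\<in>pverts G. satisfies G \<phi> (v(i := a)))"

lemma satisfies_cong:
  assumes "\<And>i. i \<in> free_vars \<phi> \<Longrightarrow> v i = w i"
  shows "satisfies G \<phi> v = satisfies G \<phi> w"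
  using assms
proof (induction \<phi> arbitrary: v w)
  case (Forall i \<phi>)
  have "satisfies G \<phi> (v(i := a)) = satisfies G \<phi> (w(i := a))" for a
    by (rule Forall.IH) (simp add: Forall.prems)
  then show ?case by simp
next
  case (Exists i \<phi>)
  have "satisfies G \<phi> (v(i := a)) = satisfies G \<phi> (w(i := a))" for a
    by (rule Exists.IH) (simp add: Exists.prems)
  then show ?case by simp
next
  case (Conj \<phi> \<psi>)
  have "satisfies G \<phi> v = satisfies G \<phi> w"
    by (rule Conj.IH(1)) (simp add: Conj.prems)
  moreover have "satisfies G \<psi> v = satisfies G \<psi> w"
    by (rule Conj.IH(2)) (simp add: Conj.prems)
  ultimately show ?case by simp
next
  case (Disj \<phi> \<psi>)
  have "satisfies G \<phi> v = satisfies G \<phi> w"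
    by (rule Disj.IH(1)) (simp add: Disj.prems)
  moreover have "satisfies G \<psi> v = satisfies G \<psi> w"
    by (rule Disj.IH(2)) (simp add: Disj.prems)
  ultimately show ?case by simp
next
  case (Neg \<phi>)
  have "satisfies G \<phi> v = satisfies G \<phi> w"
    by (rule Neg.IH) (simp add: Neg.prems)
  then show ?case by simp
qed simp_all

(* The set phi(G): p-tuples of vertices, where p = card (free_vars phi), are
   represented as extensional functions on the set of the p free variables. *)
definition solutions :: "fo_formula \<Rightarrow> 'a pair_pre_digraph \<Rightarrow> (nat \<Rightarrow> 'a) set" where
  "solutions \<phi> G = {v \<in> free_vars \<phi> \<rightarrow>\<^sub>E pverts G. satisfies G \<phi> v}"

definition strongly_polynomial :: "(nat \<Rightarrow> 'a pair_pre_digraph) \<Rightarrow> bool" where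
  "strongly_polynomial G \<longleftrightarrow>
     (\<forall>\<phi>. quantifier_free \<phi> \<longrightarrow>
        (\<exists>P :: real poly. \<forall>n. real (card (solutions \<phi> (G n))) = poly P (real n)))"

section \<open>Graphons and convergence\<close>

abbreviation unit_interval :: "real measure" where
  "unit_interval \<equiv> restrict_space lborel {0..1}"

definition graphon :: "(real \<Rightarrow> real \<Rightarrow> real) \<Rightarrow> bool" where
  "graphon W \<longleftrightarrow>
     case_prod W \<in> borel_measurable (unit_interval \<Otimes>\<^sub>M unit_interval) \<and>
     (\<forall>x\<in>{0..1}. \<forall>y\<in>{0..1}. W x y \<in> {0..1} \<and> W x y = W y x)"

definition random_free :: "(real \<Rightarrow> real \<Rightarrow> real) \<Rightarrow> bool" where
  "random_free W \<longleftrightarrow> (AE (x, y) in unit_interval \<Otimes>\<^sub>M unit_interval. W x y \<in> {0, 1})"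

definition homs :: "'b pair_pre_digraph \<Rightarrow> 'a pair_pre_digraph \<Rightarrow> ('b \<Rightarrow> 'a) set" where
  "homs F G = {f \<in> pverts F \<rightarrow>\<^sub>E pverts G. \<forall>(u, v)\<in>parcs F. (f u, f v) \<in> parcs G}"

definition hom_density :: "'b pair_pre_digraph \<Rightarrow> 'a pair_pre_digraph \<Rightarrow> real" where
  "hom_density F G = real (card (homs F G)) / real (card (pverts G)) ^ card (pverts F)"

(* The condition i < j selects each (undirected) edge of F exactly once. *)
definition graphon_density :: "nat pair_pre_digraph \<Rightarrow> (real \<Rightarrow> real \<Rightarrow> real) \<Rightarrow> real" where
  "graphon_density F W =
     (LINT x | Pi\<^sub>M (pverts F) (\<lambda>_. unit_interval).
        (\<Prod>(i, j) \<in> {(i, j) \<in> parcs F. i < j}. W (x i) (x j)))"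

(* Every finite graph is isomorphic to one whose vertices are natural numbers. *)
definition converges_to_graphon ::
    "(nat \<Rightarrow> 'a pair_pre_digraph) \<Rightarrow> (real \<Rightarrow> real \<Rightarrow> real) \<Rightarrow> bool" where
  "converges_to_graphon G W \<longleftrightarrow>
     (\<forall>F :: nat pair_pre_digraph. pair_graph F \<longrightarrow>
        (\<lambda>n. hom_density F (G n)) \<longlonglongrightarrow> graphon_density F W)"

end

theory Submission
  imports Defs "HOL-Real_Asymp.Real_Asymp"
begin

text \<open>
  Let \<open>|V(G\<^sub>n)|\<close> be a polynomial of degree \<open>d\<close> with leading coefficient \<open>a\<close>. The number of maps from
  \<open>{0..<m}\<close> to \<open>V(G\<^sub>n)\<close> inducing a given labelled graph is an integer-valued polynomial of degree at most
  \<open>dm\<close>, so its coefficient at \<open>dm\<close> is a multiple of \<open>1/(dm)!\<close>; as these coefficients add up to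
  \<open>a\<^sup>m\<close>, at most \<open>a\<^sup>m (dm)!\<close> labelled graphs on \<open>m\<close> vertices have positive limit density. This
  is \<open>2\<close> to the power \<open>o(m\<^sup>2)\<close>, so the halving algorithm predicts the edges of a random \<open>m\<close>-sample, revealed
  one after the other, with only \<open>o(m\<^sup>2)\<close> mistakes. By averaging, some edge position is predicted almost
  always, from the adjacencies of its two ends to a fixed sample. Hence, up to
  \<open>\<epsilon>|V(G\<^sub>n)|\<^sup>2\<close> pairs, the adjacency in \<open>G\<^sub>n\<close> is a fixed Boolean function of vertex labels
  from a finite set that does not depend on \<open>n\<close>.

  Realise \<open>G\<^sub>n\<close> as a \<open>0/1\<close>-valued graphon \<open>W\<^sub>n\<close> on the unit interval, ordering the vertices so that,
  along a subsequence, each label converges almost everywhere. Then \<open>W\<^sub>n\<close> is Cauchy in \<open>L\<^sup>1\<close> along this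
  subsequence, so a further subsequence converges almost everywhere to a \<open>0/1\<close>-valued graphon.
  Convergence of the whole sequence follows because every homomorphism density of \<open>G\<^sub>n\<close> is a bounded quotient
  of polynomials in \<open>n\<close>.
\<close>

section \<open>Predicting edges from a sample\<close>

definition mistakes :: "(bool list \<Rightarrow> bool) \<Rightarrow> bool list \<Rightarrow> nat" where
  "mistakes f w = (\<Sum>t<length w. of_bool (w ! t \<noteq> f (take t w)))"

lemma mistakes_Cons:
  "mistakes f (b # w) = of_bool (b \<noteq> f []) + mistakes (\<lambda>p. f (b # p)) w"
  unfolding mistakes_def by (simp add: sum.lessThan_Suc_shift del: sum.lessThan_Suc)

text \<open>The halving algorithm: predict the next bit by a majority vote among the words of \<^term>\<open>F\<close>
  that are consistent with the bits seen so far, so that every mistake halves the set of candidates.\<close>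

lemma halving_predictor:
  assumes "finite F" and "F \<subseteq> {w. length w = L}"
  shows "\<exists>f. \<forall>w\<in>F. 2 ^ mistakes f w \<le> card F"
  using assms
proof (induction L arbitrary: F)
  case 0
  then have "2 ^ mistakes f w \<le> card F" if "w \<in> F" for w and f
    using that by (auto simp: mistakes_def Suc_le_eq card_gt_0_iff)
  then show ?case by blast
next
  case (Suc L)
  define T where "T b = {w. b # w \<in> F}" for b
  have fin: "finite (T b)" for b
    unfolding T_def using finite_vimageI[OF Suc.prems(1), of "Cons b"] by (simp add: vimage_def)
  have "T b \<subseteq> {w. length w = L}" for b
    using Suc.prems(2) by (auto simp: T_def)
  then have "\<forall>b. \<exists>f. \<forall>w\<in>T b. 2 ^ mistakes f w \<le> card (T b)"
    using Suc.IH fin by blast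
  then obtain g where g: "\<And>b w. w \<in> T b \<Longrightarrow> 2 ^ mistakes (g b) w \<le> card (T b)"
    by metis
  have "F = Cons True ` T True \<union> Cons False ` T False"
  proof (rule set_eqI)
    fix w show "w \<in> F \<longleftrightarrow> w \<in> Cons True ` T True \<union> Cons False ` T False"
    proof (cases w)
      case Nil then show ?thesis using Suc.prems(2) by auto
    next
      case (Cons b v) then show ?thesis by (cases b) (auto simp: T_def)
    qed
  qed
  moreover have "card (Cons b ` T b) = card (T b)" for b
    by (simp add: card_image)
  ultimately have cF: "card F = card (T True) + card (T False)"
    using fin by (metis (no_types, lifting) card_Un_disjoint finite_imageI disjoint_iff imageE list.inject)
  define maj where "maj \<longleftrightarrow> card (T False) \<le> card (T True)"
  define f where "f p = (case p of [] \<Rightarrow> maj | b # q \<Rightarrow> g b q)" for p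
  have "2 ^ mistakes f w \<le> card F" if "w \<in> F" for w
  proof -
    have "length w = Suc L" using that Suc.prems(2) by blast
    then obtain b v where w: "w = b # v" by (cases w) auto
    then have v: "v \<in> T b" using that by (simp add: T_def)
    have "mistakes f w = of_bool (b \<noteq> maj) + mistakes (g b) v"
      by (simp add: w mistakes_Cons f_def)
    then show ?thesis
      using g[OF v] cF by (cases b; cases maj) (auto simp: maj_def)
  qed
  then show ?case by blast
qed

text \<open>Resampling one coordinate: exchanging the \<open>i\<close>-th entry of \<open>z\<close>
  with the spare value \<open>u\<close> is an involution on the pairs \<open>(z, u)\<close>. Hence
  an average over samples does not change when an entry is replaced by an independent uniform
  vertex.\<close>

lemma sum_PiE_fun_upd:
  fixes h :: "('i \<Rightarrow> 'a) \<Rightarrow> 'b::semiring_1"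
  assumes "i \<in> I"
  shows "(\<Sum>z\<in>I \<rightarrow>\<^sub>E V. \<Sum>u\<in>V. h (z(i := u))) = of_nat (card V) * (\<Sum>z\<in>I \<rightarrow>\<^sub>E V. h z)"
proof -
  have "(\<Sum>z\<in>I \<rightarrow>\<^sub>E V. \<Sum>u\<in>V. h (z(i := u))) = (\<Sum>(z, u)\<in>(I \<rightarrow>\<^sub>E V) \<times> V. h (z(i := u)))"
    by (simp add: sum.cartesian_product)
  also have "\<dots> = (\<Sum>(z, u)\<in>(I \<rightarrow>\<^sub>E V) \<times> V. h z)"
    using assms
    by (intro sum.reindex_bij_witness[where i = "\<lambda>(z, u). (z(i := u), z i)" and j = "\<lambda>(z, u). (z(i := u), z i)"])
       (auto simp: PiE_iff extensional_def)
  also have "\<dots> = (\<Sum>z\<in>I \<rightarrow>\<^sub>E V. \<Sum>u\<in>V. h z)"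
    by (simp only: sum.cartesian_product)
  finally show ?thesis
    by (simp add: sum_distrib_left)
qed

section \<open>Edge positions, adjacency patterns and vertex labels\<close>

definition index_pairs :: "nat \<Rightarrow> (nat \<times> nat) set" where
  "index_pairs m = {(i, j). i < j \<and> j < m}"

lemma finite_index_pairs [simp]: "finite (index_pairs m)"
  by (rule finite_subset[of _ "{..<m} \<times> {..<m}"]) (auto simp: index_pairs_def)

lemma card_index_pairs: "2 * card (index_pairs m) = m * (m - 1)"
proof (induction m)
  case 0 then show ?case by (simp add: index_pairs_def)
next
  case (Suc m)
  have "index_pairs (Suc m) = index_pairs m \<union> (\<lambda>i. (i, m)) ` {..<m}"
    by (auto simp: index_pairs_def)
  then have "card (index_pairs (Suc m)) = card (index_pairs m) + card ((\<lambda>i. (i, m)) ` {..<m})"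
    by (simp only:, subst card_Un_disjoint) (auto simp: index_pairs_def[abs_def] finite_index_pairs[unfolded index_pairs_def])
  also have "card ((\<lambda>i. (i, m)) ` {..<m}) = m"
    by (subst card_image) (auto simp: inj_on_def)
  finally show ?case
    using Suc by (cases m) auto
qed

definition pattern :: "('a \<Rightarrow> 'a \<Rightarrow> bool) \<Rightarrow> nat \<Rightarrow> (nat \<Rightarrow> 'a) \<Rightarrow> (nat \<times> nat) set" where
  "pattern E m z = {(i, j) \<in> index_pairs m. E (z i) (z j)}"

text \<open>Relative to a sample \<open>z 0, \<dots>, z (m - 1)\<close>, a vertex \<open>u\<close> receives the label \<open>(e, A, S)\<close>, where \<open>e = (i, j)\<close>
  is the edge position to be predicted, \<open>A\<close> is the pattern of the sample and \<open>S\<close> is the set of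
  indices of the neighbours of \<open>u\<close> in the sample. The labels of \<open>u\<close> and \<open>v\<close> determine the pattern obtained
  by replacing \<open>z i\<close> by \<open>u\<close> and \<open>z j\<close> by \<open>v\<close>, except for the pair \<open>(i, j)\<close> itself.\<close>

type_synonym label = "(nat \<times> nat) \<times> (nat \<times> nat) set \<times> nat set"

definition labels :: "nat \<Rightarrow> label set" where
  "labels m = index_pairs m \<times> Pow (index_pairs m) \<times> Pow {..<m}"

lemma finite_labels: "finite (labels m)"
  by (simp add: labels_def)

text \<open>The value at position \<open>(i, j)\<close> is arbitrary, since the prediction for that
  position reads earlier positions only. Reading \<open>E (z a) u\<close> from the neighbours of
  \<open>u\<close> relies on the symmetry of \<open>E\<close>.\<close>

fun reconstruct :: "label \<Rightarrow> label \<Rightarrow> nat \<times> nat \<Rightarrow> bool" where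
  "reconstruct ((i, j), A, S) (_, _, T) (a, b) \<longleftrightarrow>
     (if a = i then b \<in> S else if b = i then a \<in> S
      else if a = j then b \<in> T else if b = j then a \<in> T else (a, b) \<in> A)"

text \<open>On a sample with pattern in \<open>F\<close> the halving predictor errs at most
  \<open>K\<close> times, on any other sample at most once per position. Averaging first over
  positions and then over samples fixes a position \<open>(i, j)\<close> and a sample
  \<open>z\<close> for which the adjacency of two fresh vertices put at \<open>i\<close> and
  \<open>j\<close> is rarely mispredicted. The order of quantifiers matters: \<open>H\<close>
  depends on \<open>F\<close> and \<open>m\<close>, but not on the graph.\<close>

lemma predictor_labelling:
  fixes F :: "(nat \<times> nat) set set" and K :: real and m :: nat
  assumes "2 \<le> m" and "finite F" and "F \<subseteq> Pow (index_pairs m)" and "real (card F) \<le> 2 powr K" and "0 \<le> K"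
  shows "\<exists>H :: label \<Rightarrow> label \<Rightarrow> bool. \<forall>(V :: 'a set) E. finite V \<longrightarrow> V \<noteq> {} \<longrightarrow> symp E \<longrightarrow>
     (\<exists>c. c \<in> V \<rightarrow> labels m \<and>
       real (card {(u, v) \<in> V \<times> V. E u v \<noteq> H (c u) (c v)}) \<le>
         (K / real (card (index_pairs m)) +
          real (card {z \<in> {..<m} \<rightarrow>\<^sub>E V. pattern E m z \<notin> F}) / real (card V) ^ m) * (real (card V))\<^sup>2)"
proof -
  obtain es where es: "set es = index_pairs m" "distinct es"
    using finite_distinct_list[OF finite_index_pairs] by blast
  define L where "L = length es"
  have L: "L = card (index_pairs m)"
    using es distinct_card unfolding L_def by metis
  have "(0, 1) \<in> index_pairs m" using assms(1) by (simp add: index_pairs_def)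
  then have "L > 0" unfolding L by (auto simp: card_gt_0_iff)
  define str where "str A = map (\<lambda>e. e \<in> A) es" for A :: "(nat \<times> nat) set"
  have "finite (str ` F)" "str ` F \<subseteq> {w. length w = L}"
    using assms(2) by (auto simp: str_def L_def)
  from halving_predictor[OF this] obtain f where
    f: "\<And>A. A \<in> F \<Longrightarrow> 2 ^ mistakes f (str A) \<le> card (str ` F)" by blast
  have mistK: "real (mistakes f (str A)) \<le> K" if "A \<in> F" for A
  proof -
    have "2 powr real (mistakes f (str A)) = real (2 ^ mistakes f (str A))"
      by (simp add: powr_realpow)
    also have "\<dots> \<le> real (card (str ` F))"
      using f[OF that] by (rule of_nat_mono)
    also have "\<dots> \<le> real (card F)"
      using card_image_le[OF assms(2)] by simp
    also have "\<dots> \<le> 2 powr K" by fact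
    finally show ?thesis by simp
  qed
  define pos where "pos e = (THE t. t < L \<and> es ! t = e)" for e
  have pos: "pos (es ! t) = t" if "t < L" for t
    unfolding pos_def using that es(2) by (intro the_equality) (auto simp: L_def nth_eq_iff_index_eq)
  \<comment> \<open>The position to be predicted varies with the graph; reading it from the label
    lets one \<open>H\<close> serve all graphs.\<close>
  define H where "H l l' = f (take (pos (fst l)) (map (reconstruct l l') es))" for l l' :: label
  show ?thesis
  proof (intro exI[of _ H] allI impI)
    fix V :: "'a set" and E :: "'a \<Rightarrow> 'a \<Rightarrow> bool"
    assume V: "finite V" "V \<noteq> {}" and E: "symp E"
    let ?Z = "{..<m} \<rightarrow>\<^sub>E V"
    let ?N = "real (card V)"
    have N: "?N > 0" using V by (simp add: card_gt_0_iff)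
    have finZ: "finite ?Z" using V by (intro finite_PiE) auto
    have cardZ: "real (card ?Z) = ?N ^ m" by (simp add: card_PiE)
    let ?bad = "real (card {z \<in> ?Z. pattern E m z \<notin> F})"
    define w where "w z = str (pattern E m z)" for z
    define err where "err t z = (of_bool (w z ! t \<noteq> f (take t (w z))) :: real)" for t z
    have lw: "length (w z) = L" for z by (simp add: w_def str_def L_def)
    have "(\<Sum>t<L. err t z) \<le> K + real L * of_bool (pattern E m z \<notin> F)" if "z \<in> ?Z" for z
    proof -
      have eq: "(\<Sum>t<L. err t z) = real (mistakes f (w z))"
        by (simp add: mistakes_def lw err_def)
      show ?thesis
      proof (cases "pattern E m z \<in> F")
        case True
        then show ?thesis using mistK[OF True] eq by (simp add: w_def)
      next
        case False
        have "(\<Sum>t<L. err t z) \<le> (\<Sum>t<L. 1)" by (intro sum_mono) (simp add: err_def)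
        then show ?thesis using False assms(5) by simp
      qed
    qed
    then have "(\<Sum>z\<in>?Z. \<Sum>t<L. err t z) \<le> (\<Sum>z\<in>?Z. K + real L * of_bool (pattern E m z \<notin> F))"
      by (rule sum_mono)
    also have "\<dots> = ?N ^ m * K + real L * ?bad"
      using finZ cardZ by (simp add: sum.distrib sum_distrib_left[symmetric] Int_def)
    finally have *: "(\<Sum>t<L. \<Sum>z\<in>?Z. err t z) \<le> ?N ^ m * K + real L * ?bad"
      by (subst sum.swap)
    define B where "B = K / real L + ?bad / ?N ^ m"
    \<comment> \<open>Pigeonhole over the \<open>L\<close> positions: \<open>B\<close> bounds the
      mean error per position and sample.\<close>
    have "\<exists>t<L. (\<Sum>z\<in>?Z. err t z) \<le> ?N ^ m * B"
    proof (rule ccontr)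
      assume "\<not> ?thesis"
      then have "(\<Sum>t<L. ?N ^ m * B) < (\<Sum>t<L. \<Sum>z\<in>?Z. err t z)"
        using \<open>L > 0\<close> by (intro sum_strict_mono) auto
      moreover have "(\<Sum>t<L. ?N ^ m * B) = ?N ^ m * K + real L * ?bad"
        using N \<open>L > 0\<close> by (simp add: B_def field_simps)
      ultimately show False using * by simp
    qed
    then obtain t where t: "t < L" and errt: "(\<Sum>z\<in>?Z. err t z) \<le> ?N ^ m * B" by blast
    obtain i j where ij: "es ! t = (i, j)" by fastforce
    then have "(i, j) \<in> index_pairs m" using t es(1) nth_mem unfolding L_def by metis
    then have ij': "i < j" "j < m" by (auto simp: index_pairs_def)
    have avg: "(\<Sum>z\<in>?Z. \<Sum>u\<in>V. \<Sum>v\<in>V. err t (z(i := u, j := v))) = ?N\<^sup>2 * (\<Sum>z\<in>?Z. err t z)"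
    proof -
      have "(\<Sum>z\<in>?Z. \<Sum>u\<in>V. \<Sum>v\<in>V. err t (z(i := u, j := v))) = ?N * (\<Sum>z\<in>?Z. \<Sum>v\<in>V. err t (z(j := v)))"
        using sum_PiE_fun_upd[of i "{..<m}" "\<lambda>z. \<Sum>v\<in>V. err t (z(j := v))" V] ij' by simp
      also have "(\<Sum>z\<in>?Z. \<Sum>v\<in>V. err t (z(j := v))) = ?N * (\<Sum>z\<in>?Z. err t z)"
        by (rule sum_PiE_fun_upd) (use ij' in simp)
      finally show ?thesis by (simp only: power2_eq_square mult.assoc)
    qed
    \<comment> \<open>By \<open>avg\<close> the mean error over \<open>z\<close>, \<open>u\<close>
      and \<open>v\<close> is still at most \<open>B\<close>, so some sample \<open>z\<close> does
      at least as well when only \<open>u\<close> and \<open>v\<close> vary.\<close>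
    have "\<exists>z\<in>?Z. (\<Sum>u\<in>V. \<Sum>v\<in>V. err t (z(i := u, j := v))) \<le> B * ?N\<^sup>2"
    proof (rule ccontr)
      assume "\<not> ?thesis"
      then have "(\<Sum>z\<in>?Z. B * ?N\<^sup>2) < (\<Sum>z\<in>?Z. \<Sum>u\<in>V. \<Sum>v\<in>V. err t (z(i := u, j := v)))"
        using finZ V by (intro sum_strict_mono) (auto simp: PiE_eq_empty_iff)
      also have "\<dots> = ?N\<^sup>2 * (\<Sum>z\<in>?Z. err t z)" by (rule avg)
      also have "\<dots> \<le> ?N\<^sup>2 * (?N ^ m * B)" by (intro mult_left_mono errt) simp
      also have "\<dots> = (\<Sum>z\<in>?Z. B * ?N\<^sup>2)" using cardZ by simp
      finally show False by simp
    qed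
    then obtain z where z: "z \<in> ?Z" and errz: "(\<Sum>u\<in>V. \<Sum>v\<in>V. err t (z(i := u, j := v))) \<le> B * ?N\<^sup>2"
      by blast
    define c where "c u = ((i, j), pattern E m z, {l. l < m \<and> E u (z l)})" for u
    have "w (z(i := u, j := v)) ! t \<noteq> f (take t (w (z(i := u, j := v)))) \<longleftrightarrow> E u v \<noteq> H (c u) (c v)" for u v
    proof -
      let ?z = "z(i := u, j := v)"
      have "w ?z ! t \<longleftrightarrow> E u v"
        using t ij ij' by (auto simp: w_def str_def L_def pattern_def index_pairs_def)
      \<comment> \<open>The first \<open>t\<close> bits avoid position \<open>(i, j)\<close> because
        \<open>es\<close> is distinct, so the labels of \<open>u\<close> and \<open>v\<close>
        determine them.\<close>
      moreover have "take t (w ?z) = take t (map (reconstruct (c u) (c v)) es)"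
      proof (rule nth_equalityI)
        show "length (take t (w ?z)) = length (take t (map (reconstruct (c u) (c v)) es))"
          by (simp add: lw L_def)
        fix s assume "s < length (take t (w ?z))"
        then have s: "s < t" "s < L" using t by (auto simp: lw)
        obtain a b where ab: "es ! s = (a, b)" by fastforce
        then have "(a, b) \<in> index_pairs m" using s es(1) nth_mem unfolding L_def by metis
        moreover have "(a, b) \<noteq> (i, j)"
          using s t es(2) ab ij unfolding L_def by (metis less_irrefl nth_eq_iff_index_eq)
        ultimately have "(a, b) \<in> pattern E m ?z \<longleftrightarrow> reconstruct (c u) (c v) (a, b)"
          using ij' E by (auto simp: pattern_def c_def index_pairs_def dest: sympD)
        then show "take t (w ?z) ! s = take t (map (reconstruct (c u) (c v)) es) ! s"
          using s ab by (simp add: w_def str_def L_def)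
      qed
      moreover have "pos (fst (c u)) = t"
        using pos[OF t] ij by (simp add: c_def)
      ultimately show ?thesis by (simp add: H_def)
    qed
    then have "err t (z(i := u, j := v)) = of_bool (E u v \<noteq> H (c u) (c v))" for u v
      by (simp add: err_def)
    then have "(\<Sum>u\<in>V. \<Sum>v\<in>V. err t (z(i := u, j := v))) = (\<Sum>(u, v)\<in>V \<times> V. of_bool (E u v \<noteq> H (c u) (c v)))"
      by (simp add: sum.cartesian_product)
    also have "\<dots> = real (card {(u, v) \<in> V \<times> V. E u v \<noteq> H (c u) (c v)})"
      using V by (simp add: case_prod_unfold Int_def mem_Times_iff conj_assoc)
    finally have "real (card {(u, v) \<in> V \<times> V. E u v \<noteq> H (c u) (c v)}) \<le> B * ?N\<^sup>2"
      using errz by simp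
    moreover have "c \<in> V \<rightarrow> labels m"
      using ij' by (auto simp: c_def labels_def pattern_def index_pairs_def)
    ultimately show "\<exists>c. c \<in> V \<rightarrow> labels m \<and>
       real (card {(u, v) \<in> V \<times> V. E u v \<noteq> H (c u) (c v)}) \<le>
         (K / real (card (index_pairs m)) + ?bad / ?N ^ m) * ?N\<^sup>2"
      unfolding B_def L by blast
  qed
qed

section \<open>Integer-valued polynomials and pattern counts\<close>

lemma pcompose_monom: "pcompose (monom c i) q = smult c (q ^ i)"
  for c :: "'a::comm_semiring_1"
  by (induction i) (simp_all add: monom_Suc pcompose_pCons monom_0)

text \<open>Binomial expansion of \<open>Q (X + 1)\<close>, from which the coefficients of the
  finite difference of \<open>Q\<close> are read off.\<close>

lemma coeff_pcompose_shift:
  fixes Q :: "'a::comm_ring_1 poly"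
  assumes "degree Q \<le> n"
  shows "coeff (pcompose Q [:1, 1:]) j = (\<Sum>i\<le>n. coeff Q i * of_nat (i choose j))"
proof -
  have "coeff ([:1, 1:] ^ i) j = (of_nat (i choose j) :: 'a)" for i
    by (cases "j \<le> i") (simp_all add: coeff_linear_poly_power coeff_eq_0 degree_linear_power binomial_eq_0)
  moreover have "pcompose Q [:1, 1:] = (\<Sum>i\<le>n. smult (coeff Q i) ([:1, 1:] ^ i))"
    by (subst poly_as_sum_of_monoms'[OF assms, symmetric]) (simp add: pcompose_sum pcompose_monom)
  ultimately show ?thesis by (simp add: coeff_sum)
qed

text \<open>Finite differences preserve integrality and multiply the top coefficient by the degree.\<close>

lemma integer_valued_poly_coeff:
  fixes Q :: "real poly"
  assumes "degree Q \<le> D" and "\<And>n :: nat. poly Q (real n) \<in> \<int>"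
  shows "coeff Q D * fact D \<in> \<int>"
  using assms
proof (induction D arbitrary: Q)
  case 0
  then obtain c where "Q = [:c:]" using degree_eq_zeroE by blast
  then show ?case using "0.prems"(2)[of 0] by simp
next
  case (Suc D)
  define R where "R = pcompose Q [:1, 1:] - Q"
  have coeff_R: "coeff R j = (\<Sum>i\<le>Suc D. coeff Q i * of_nat (i choose j)) - coeff Q j" for j
    unfolding R_def by (simp add: coeff_pcompose_shift[OF Suc.prems(1)] del: sum.atMost_Suc)
  have "coeff R j = 0" if "D < j" for j
  proof (cases "j = Suc D")
    case True
    then show ?thesis by (simp add: coeff_R binomial_eq_0)
  next
    case False
    then have "Suc D < j" using that by simp
    then have "coeff Q j = 0" using Suc.prems(1) by (simp add: coeff_eq_0)
    then show ?thesis using \<open>Suc D < j\<close> by (simp add: coeff_R binomial_eq_0)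
  qed
  then have "degree R \<le> D" by (intro degree_le) auto
  moreover have "poly R (real n) \<in> \<int>" for n
    using Suc.prems(2)[of "Suc n"] Suc.prems(2)[of n] by (simp add: R_def poly_pcompose add.commute)
  ultimately have "coeff R D * fact D \<in> \<int>" by (rule Suc.IH)
  moreover have "coeff R D = real (Suc D) * coeff Q (Suc D)"
  proof -
    have "(\<Sum>i\<le>D. coeff Q i * of_nat (i choose D)) = coeff Q D"
      by (cases D) (simp_all add: binomial_eq_0)
    then show ?thesis by (simp add: coeff_R)
  qed
  ultimately show ?case by (simp add: mult_ac)
qed

section \<open>Limits and growth of polynomials along the natural numbers\<close>

lemma filterlim_real_at_infinity: "filterlim real at_infinity sequentially"
  by (rule filterlim_at_top_imp_at_infinity[OF filterlim_real_sequentially])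

text \<open>Here \<open>D\<close> only bounds the degree, so the limit may be zero; this separates
  patterns of positive limit density from negligible ones.\<close>

lemma poly_over_power_tendsto:
  fixes Q :: "real poly"
  assumes "degree Q \<le> D"
  shows "(\<lambda>n. poly Q (real n) / real n ^ D) \<longlonglongrightarrow> coeff Q D"
proof -
  have "(\<lambda>n. real n ^ i / real n ^ D) \<longlonglongrightarrow> of_bool (i = D)" if "i \<le> D" for i
  proof (cases "i = D")
    case True
    have "\<forall>\<^sub>F n in sequentially. 1 = real n ^ D / real n ^ D"
      using eventually_gt_at_top[of 0] by eventually_elim simp
    then show ?thesis using True by (simp add: tendsto_eventually eventually_mono)
  next
    case False
    then have "i < D" using that by simp
    then have "(\<lambda>n. real n ^ i / real n ^ D) \<longlonglongrightarrow> 0"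
      using filterlim_compose[OF poly_divide_tendsto_0_at_infinity[of "monom (1::real) i" "monom 1 D"] filterlim_real_at_infinity]
      by (simp add: degree_monom_eq poly_monom)
    then show ?thesis using False by simp
  qed
  then have "(\<lambda>n. \<Sum>i\<le>D. coeff Q i * (real n ^ i / real n ^ D)) \<longlonglongrightarrow> (\<Sum>i\<le>D. coeff Q i * of_bool (i = D))"
    by (intro tendsto_sum tendsto_mult tendsto_const) auto
  also have "(\<lambda>n. \<Sum>i\<le>D. coeff Q i * (real n ^ i / real n ^ D)) = (\<lambda>n. poly Q (real n) / real n ^ D)"
    by (subst (2) poly_as_sum_of_monoms'[OF assms, symmetric])
       (simp add: poly_sum poly_monom sum_divide_distrib)
  finally show ?thesis by (simp add: of_bool_def if_distrib cong: if_cong)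
qed

text \<open>If \<open>Q\<close> had the larger degree, \<open>R / Q\<close> would tend to zero and
  \<open>Q\<close> would eventually be non-zero, so \<open>Q\<close> would eventually exceed
  \<open>R\<close> in absolute value.\<close>

lemma degree_le_of_abs_le:
  fixes Q R :: "real poly"
  assumes "\<forall>\<^sub>F n in sequentially. \<bar>poly Q (real n)\<bar> \<le> \<bar>poly R (real n)\<bar>"
  shows "degree Q \<le> degree R"
proof (rule ccontr)
  assume "\<not> ?thesis"
  then have deg: "degree R < degree Q" by simp
  then have "Q \<noteq> 0" by auto
  have "(\<lambda>n. poly R (real n) / poly Q (real n)) \<longlonglongrightarrow> 0"
    by (rule filterlim_compose[OF poly_divide_tendsto_0_at_infinity[OF deg] filterlim_real_at_infinity])
  then have "\<forall>\<^sub>F n in sequentially. \<bar>poly R (real n) / poly Q (real n)\<bar> < 1"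
    using tendstoD[where e = 1 and l = "0::real"] by (fastforce simp: dist_real_def)
  moreover have "\<forall>\<^sub>F n in sequentially. poly Q (real n) \<noteq> 0"
  proof -
    have "filterlim (\<lambda>n. poly Q (real n)) at_infinity sequentially"
      using filterlim_compose[OF filterlim_poly_at_infinity filterlim_real_at_infinity] deg by simp
    then show ?thesis
      using filterlim_at_infinity_imp_eventually_ne[of _ _ 0] by blast
  qed
  ultimately have "\<forall>\<^sub>F n :: nat in sequentially. False"
    using assms by eventually_elim (auto simp: field_simps)
  then show False by simp
qed

lemma eventually_poly_nonzero:
  fixes P :: "real poly"
  assumes "P \<noteq> 0"
  shows "\<forall>\<^sub>F n in sequentially. poly P (real n) \<noteq> 0"
proof -
  have "finite (real -` {x. poly P x = 0})"
    using poly_roots_finite[OF assms] by (intro finite_vimageI) (auto intro: inj_of_nat)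
  then show ?thesis
    by (simp add: cofinite_eq_sequentially[symmetric] eventually_cofinite vimage_def)
qed

text \<open>The domination bounds the degree of \<open>Q\<close> by that of \<open>R\<close>. After
  division by the power of \<open>n\<close> of degree \<open>D\<close>, the denominator tends to the
  leading coefficient of \<open>R\<close>, which is non-zero.\<close>

lemma poly_ratio_convergent:
  fixes Q R :: "real poly"
  assumes "R \<noteq> 0" and "\<forall>\<^sub>F n in sequentially. \<bar>poly Q (real n)\<bar> \<le> \<bar>poly R (real n)\<bar>"
  shows "convergent (\<lambda>n. poly Q (real n) / poly R (real n))"
proof -
  define D where "D = degree R"
  have "degree Q \<le> D" using degree_le_of_abs_le[OF assms(2)] by (simp add: D_def)
  then have "(\<lambda>n. (poly Q (real n) / real n ^ D) / (poly R (real n) / real n ^ D)) \<longlonglongrightarrow> coeff Q D / coeff R D"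
    using assms(1) by (intro tendsto_divide poly_over_power_tendsto) (auto simp: D_def)
  moreover have "\<forall>\<^sub>F n in sequentially. (poly Q (real n) / real n ^ D) / (poly R (real n) / real n ^ D) = poly Q (real n) / poly R (real n)"
    using eventually_gt_at_top[of 0] by eventually_elim simp
  ultimately show ?thesis
    unfolding convergent_def using tendsto_cong by fast
qed

section \<open>The choice of the sample size\<close>

lemma log_fact_over_square_tendsto:
  assumes "0 < A"
  shows "(\<lambda>m. (real m * log 2 A + real (d * m) * log 2 (real (d * m) + 1)) / (real m * (real m - 1) / 2)) \<longlonglongrightarrow> 0"
\<comment> \<open>For \<open>d = 0\<close> the factorial term vanishes and the numerator is linear
  in \<open>m\<close>; otherwise it is of order \<open>m\<close> times its logarithm.\<close>
proof (cases "d = 0")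
  case True
  then show ?thesis using assms by (simp only: mult_zero_left of_nat_0 add_0_right) real_asymp
next
  case False
  then have "real d > 0" by simp
  then show ?thesis unfolding of_nat_mult log_def by real_asymp
qed

text \<open>A crude bound suffices against a quadratic number of edge positions. The added 1 keeps
  the argument of the logarithm positive at \<open>k = 0\<close>.\<close>

lemma log_fact_le: "log 2 (fact k) \<le> real k * log 2 (real k + 1)"
proof -
  have "(fact k :: real) \<le> (real k + 1) ^ k"
    using fact_le_power[of k, where 'a = real] power_mono[of "real k" "real k + 1" k] by simp
  then have "log 2 (fact k) \<le> log 2 ((real k + 1) ^ k)" by simp
  also have "\<dots> = real k * log 2 (real k + 1)" by (simp add: log_nat_power)
  finally show ?thesis .
qed

text \<open>The numerator is the mistake bound \<open>K\<close> fed to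
  \<open>predictor_labelling\<close>; it is at most of order \<open>m\<close> times its logarithm,
  whereas the number of positions grows quadratically.\<close>

lemma exists_small_predictor_bound:
  fixes A \<epsilon> :: real and d :: nat
  assumes "0 < A" "0 < \<epsilon>"
  shows "\<exists>m\<ge>2. log 2 (A ^ m * fact (d * m)) / real (card (index_pairs m)) < \<epsilon>"
proof -
  let ?g = "\<lambda>m. (real m * log 2 A + real (d * m) * log 2 (real (d * m) + 1)) / (real m * (real m - 1) / 2)"
  have "\<forall>\<^sub>F m in sequentially. ?g m < \<epsilon>"
    by (rule order_tendstoD(2)[OF log_fact_over_square_tendsto[OF assms(1)] assms(2)])
  then have "\<forall>\<^sub>F m in sequentially. 2 \<le> m \<and> ?g m < \<epsilon>"
    using eventually_ge_at_top[of 2] by eventually_elim simp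
  then obtain m where m: "2 \<le> m" "?g m < \<epsilon>"
    using eventually_happens' sequentially_bot by blast
  have "real (2 * card (index_pairs m)) = real m * (real m - 1)"
    using m(1) by (simp only: card_index_pairs) (simp add: of_nat_diff)
  then have cp: "real (card (index_pairs m)) = real m * (real m - 1) / 2" by simp
  have "log 2 (A ^ m * fact (d * m)) = real m * log 2 A + log 2 (fact (d * m))"
    using assms by (simp add: log_mult log_nat_power)
  also have "\<dots> \<le> real m * log 2 A + real (d * m) * log 2 (real (d * m) + 1)"
    using log_fact_le[of "d * m"] by simp
  finally have "log 2 (A ^ m * fact (d * m)) / real (card (index_pairs m)) \<le> ?g m"
    unfolding cp using m(1) by (intro divide_right_mono) auto
  then show ?thesis using m by (intro exI[of _ m]) linarith
qed

lemma polynomial_patterns_labelling: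
  fixes V :: "nat \<Rightarrow> 'a set" and E :: "nat \<Rightarrow> 'a \<Rightarrow> 'a \<Rightarrow> bool" and P :: "real poly"
  assumes V: "\<And>n. finite (V n)" and E: "\<And>n. symp (E n)" and "P \<noteq> 0"
    and P: "\<And>n. real (card (V n)) = poly P (real n)"
    and Q: "\<And>m A. 2 \<le> m \<Longrightarrow> A \<subseteq> index_pairs m \<Longrightarrow>
       \<exists>Q :: real poly. \<forall>n. real (card {z \<in> {..<m} \<rightarrow>\<^sub>E V n. pattern (E n) m z = A}) = poly Q (real n)"
    and "0 < \<epsilon>"
  shows "\<exists>(Lab :: label set) H. finite Lab \<and> (\<forall>\<^sub>F n in sequentially. \<exists>c \<in> V n \<rightarrow> Lab.
     real (card {(u, v) \<in> V n \<times> V n. E n u v \<noteq> H (c u) (c v)}) \<le> \<epsilon> * (real (card (V n)))\<^sup>2)"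
proof -
  define d where "d = degree P"
  define a where "a = lead_coeff P"
  have "a \<noteq> 0" using \<open>P \<noteq> 0\<close> by (simp add: a_def)
  have limP: "(\<lambda>n. real (card (V n)) / real n ^ d) \<longlonglongrightarrow> a"
    unfolding P a_def d_def by (rule poly_over_power_tendsto) simp
  then have "0 \<le> a" by (rule LIMSEQ_le_const) simp
  with \<open>a \<noteq> 0\<close> have "0 < a" by simp
  \<comment> \<open>Raising \<open>a\<close> to at least 1 makes \<open>K\<close> non-negative, as
    \<open>predictor_labelling\<close> requires.\<close>
  define a' where "a' = max 1 a"
  have a': "0 < a'" "1 \<le> a'" "a \<le> a'" by (auto simp: a'_def)
  obtain m where m: "2 \<le> m" and small: "log 2 (a' ^ m * fact (d * m)) / real (card (index_pairs m)) < \<epsilon> / 2"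
    using exists_small_predictor_bound[OF a'(1), of "\<epsilon> / 2" d] \<open>0 < \<epsilon>\<close> by auto
  define K where "K = log 2 (a' ^ m * fact (d * m))"
  define count where "count n A = card {z \<in> {..<m} \<rightarrow>\<^sub>E V n. pattern (E n) m z = A}" for n A
  have "\<forall>A. \<exists>Q :: real poly. A \<subseteq> index_pairs m \<longrightarrow> (\<forall>n. real (count n A) = poly Q (real n))"
    using Q[OF m] unfolding count_def by blast
  from choice[OF this] obtain q :: "(nat \<times> nat) set \<Rightarrow> real poly"
    where q: "\<And>A n. A \<subseteq> index_pairs m \<Longrightarrow> real (count n A) = poly (q A) (real n)"
    by blast
  have fin: "finite ({..<m} \<rightarrow>\<^sub>E V n)" for n using V by (intro finite_PiE) auto
  have sub: "pattern (E n) m z \<in> Pow (index_pairs m)" for n z by (auto simp: pattern_def)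
  have sum_count: "(\<Sum>A\<in>\<A>. real (count n A)) = real (card {z \<in> {..<m} \<rightarrow>\<^sub>E V n. pattern (E n) m z \<in> \<A>})"
    if "finite \<A>" for n \<A>
  proof -
    have "{z \<in> {..<m} \<rightarrow>\<^sub>E V n. pattern (E n) m z \<in> \<A>} = (\<Union>A\<in>\<A>. {z \<in> {..<m} \<rightarrow>\<^sub>E V n. pattern (E n) m z = A})"
      by auto
    also have "card \<dots> = (\<Sum>A\<in>\<A>. count n A)"
      unfolding count_def using that fin by (intro card_UN_disjoint) auto
    finally show ?thesis by simp
  qed
  have total: "(\<Sum>A\<in>Pow (index_pairs m). real (count n A)) = real (card (V n)) ^ m" for n
    by (subst sum_count) (use sub in \<open>auto simp: card_PiE\<close>)
  \<comment> \<open>Every pattern count is at most \<open>card (V n) ^ m\<close>, a polynomial in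
    \<open>n\<close> of degree at most \<open>D\<close>.\<close>
  define D where "D = d * m"
  have deg: "degree (q A) \<le> D" if "A \<subseteq> index_pairs m" for A
  proof -
    have "real (count n A) \<le> real (card (V n)) ^ m" for n
      unfolding total[symmetric] using that by (intro member_le_sum) auto
    then have "degree (q A) \<le> degree (P ^ m)"
      using q[OF that] P by (intro degree_le_of_abs_le always_eventually) (metis abs_ge_self abs_of_nat order_trans poly_power)
    also have "\<dots> \<le> D" by (simp add: D_def d_def degree_power_le)
    finally show ?thesis .
  qed
  have lim_count: "(\<lambda>n. real (count n A) / real n ^ D) \<longlonglongrightarrow> coeff (q A) D" if "A \<subseteq> index_pairs m" for A
    unfolding q[OF that] by (rule poly_over_power_tendsto[OF deg[OF that]])
  have coeff_nonneg: "0 \<le> coeff (q A) D" if "A \<subseteq> index_pairs m" for A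
    by (rule LIMSEQ_le_const[OF lim_count[OF that]]) simp
  have limPm: "(\<lambda>n. real (card (V n)) ^ m / real n ^ D) \<longlonglongrightarrow> a ^ m"
    using tendsto_power[OF limP, of m] by (simp add: D_def power_divide power_mult)
  have sum_coeff: "(\<Sum>A\<in>Pow (index_pairs m). coeff (q A) D) = a ^ m"
  proof (rule LIMSEQ_unique)
    show "(\<lambda>n. \<Sum>A\<in>Pow (index_pairs m). real (count n A) / real n ^ D) \<longlonglongrightarrow> (\<Sum>A\<in>Pow (index_pairs m). coeff (q A) D)"
      using lim_count by (intro tendsto_sum) auto
    show "(\<lambda>n. \<Sum>A\<in>Pow (index_pairs m). real (count n A) / real n ^ D) \<longlonglongrightarrow> a ^ m"
      using limPm by (simp add: sum_divide_distrib[symmetric] total)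
  qed
  \<comment> \<open>The patterns of positive limit density. Each coefficient here is a positive
    integer divided by \<open>fact D\<close>, and all coefficients add up to \<open>a ^ m\<close>,
    so there are at most \<open>a ^ m * fact D\<close> of them.\<close>
  define F where "F = {A. A \<subseteq> index_pairs m \<and> coeff (q A) D \<noteq> 0}"
  have F: "F \<subseteq> Pow (index_pairs m)" by (auto simp: F_def)
  then have "finite F" by (rule finite_subset) simp
  have "real (card F) = (\<Sum>A\<in>F. 1)" by simp
  also have "\<dots> \<le> (\<Sum>A\<in>F. coeff (q A) D * fact D)"
  proof (rule sum_mono)
    fix A assume A: "A \<in> F"
    then have "coeff (q A) D * fact D \<in> \<int>"
      using q[of A, symmetric] by (intro integer_valued_poly_coeff deg) (auto simp: F_def)
    moreover have "0 < coeff (q A) D * fact D"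
      using A coeff_nonneg[of A] by (simp add: F_def less_le)
    ultimately show "1 \<le> coeff (q A) D * fact D"
      by (auto elim!: Ints_cases)
  qed
  also have "\<dots> \<le> (\<Sum>A\<in>Pow (index_pairs m). coeff (q A) D * fact D)"
    using F coeff_nonneg by (intro sum_mono2) auto
  also have "\<dots> = a ^ m * fact D"
    by (simp add: sum_distrib_right[symmetric] sum_coeff)
  also have "\<dots> \<le> a' ^ m * fact (d * m)"
    unfolding D_def using \<open>0 < a\<close> a' by (intro mult_right_mono power_mono) auto
  also have "\<dots> = 2 powr K"
    unfolding K_def using a' by simp
  finally have cardF: "real (card F) \<le> 2 powr K" .
  have "1 \<le> a' ^ m * (fact (d * m) :: real)"
    using mult_mono[of 1 "a' ^ m" 1 "fact (d * m) :: real"] a' by simp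
  then have "0 \<le> K" unfolding K_def by simp
  define bad where "bad n = real (card {z \<in> {..<m} \<rightarrow>\<^sub>E V n. pattern (E n) m z \<notin> F}) / real (card (V n)) ^ m" for n
  \<comment> \<open>The patterns outside \<open>F\<close> are finitely many, and the count of each
    is of smaller order than \<open>card (V n) ^ m\<close>.\<close>
  have "bad \<longlonglongrightarrow> 0"
  proof -
    define C where "C = Pow (index_pairs m) - F"
    have bad_eq: "bad n = (\<Sum>A\<in>C. real (count n A)) / real (card (V n)) ^ m" for n
      unfolding bad_def by (subst sum_count) (use sub in \<open>auto simp: C_def intro!: arg_cong[where f = card]\<close>)
    have "(\<lambda>n. (\<Sum>A\<in>C. real (count n A) / real n ^ D) / (real (card (V n)) ^ m / real n ^ D)) \<longlonglongrightarrow> (\<Sum>A\<in>C. coeff (q A) D) / a ^ m"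
      using \<open>0 < a\<close> by (intro tendsto_divide limPm tendsto_sum lim_count) (auto simp: C_def)
    moreover have "(\<Sum>A\<in>C. coeff (q A) D) = 0"
      by (intro sum.neutral) (auto simp: C_def F_def)
    moreover have "\<forall>\<^sub>F n in sequentially.
        (\<Sum>A\<in>C. real (count n A) / real n ^ D) / (real (card (V n)) ^ m / real n ^ D) = bad n"
      using eventually_gt_at_top[of 0]
      by eventually_elim (simp add: bad_eq sum_divide_distrib[symmetric])
    ultimately show ?thesis using tendsto_cong by fastforce
  qed
  then have "\<forall>\<^sub>F n in sequentially. bad n < \<epsilon> / 2"
    using \<open>0 < \<epsilon>\<close> by (intro order_tendstoD(2)) auto
  moreover have "\<forall>\<^sub>F n in sequentially. V n \<noteq> {}"
    using eventually_poly_nonzero[OF \<open>P \<noteq> 0\<close>] by eventually_elim (auto simp: P[symmetric])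
  ultimately have ev: "\<forall>\<^sub>F n in sequentially. bad n < \<epsilon> / 2 \<and> V n \<noteq> {}"
    by (rule eventually_conj)
  obtain H where H: "\<forall>(W :: 'a set) R. finite W \<longrightarrow> W \<noteq> {} \<longrightarrow> symp R \<longrightarrow>
     (\<exists>c. c \<in> W \<rightarrow> labels m \<and> real (card {(u, v) \<in> W \<times> W. R u v \<noteq> H (c u) (c v)}) \<le>
         (K / real (card (index_pairs m)) +
          real (card {z \<in> {..<m} \<rightarrow>\<^sub>E W. pattern R m z \<notin> F}) / real (card W) ^ m) * (real (card W))\<^sup>2)"
    by (rule exE[OF predictor_labelling[OF m \<open>finite F\<close> F cardF \<open>0 \<le> K\<close>, where 'a = 'a]])
  have "\<forall>\<^sub>F n in sequentially. \<exists>c \<in> V n \<rightarrow> labels m.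
     real (card {(u, v) \<in> V n \<times> V n. E n u v \<noteq> H (c u) (c v)}) \<le> \<epsilon> * (real (card (V n)))\<^sup>2"
    using ev
  proof eventually_elim
    fix n assume n: "bad n < \<epsilon> / 2 \<and> V n \<noteq> {}"
    obtain c where c: "c \<in> V n \<rightarrow> labels m" and
      err: "real (card {(u, v) \<in> V n \<times> V n. E n u v \<noteq> H (c u) (c v)}) \<le>
         (K / real (card (index_pairs m)) + bad n) * (real (card (V n)))\<^sup>2"
      using H[rule_format, OF V _ E[of n], of n] n unfolding bad_def by blast
    have "(K / real (card (index_pairs m)) + bad n) * (real (card (V n)))\<^sup>2 \<le> \<epsilon> * (real (card (V n)))\<^sup>2"
      using small n[THEN conjunct1] unfolding K_def by (intro mult_right_mono) (linarith, simp)
    with err have "real (card {(u, v) \<in> V n \<times> V n. E n u v \<noteq> H (c u) (c v)}) \<le> \<epsilon> * (real (card (V n)))\<^sup>2"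
      by (rule order_trans)
    with c show "\<exists>c \<in> V n \<rightarrow> labels m.
       real (card {(u, v) \<in> V n \<times> V n. E n u v \<noteq> H (c u) (c v)}) \<le> \<epsilon> * (real (card (V n)))\<^sup>2"
      by blast
  qed
  then show ?thesis using finite_labels by blast
qed

section \<open>Vertex orderings with convergent labels\<close>

text \<open>Base 3 with digits 0 and 1 leaves gaps: all digits after place \<open>t\<close> together
  weigh half as much as a digit at place \<open>t\<close>. Base 2 would identify distinct
  sequences.\<close>

definition cantor_code :: "(nat \<Rightarrow> bool) \<Rightarrow> real" where
  "cantor_code b = (\<Sum>t. of_bool (b t) * (1 / 3) ^ t)"

lemma summable_cantor_code: "summable (\<lambda>t. of_bool (b t) * (1 / 3 :: real) ^ t)"
  by (rule summable_comparison_test'[of "\<lambda>t. (1 / 3 :: real) ^ t" 0]) auto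

lemma cantor_code_bounds: "\<bar>cantor_code b\<bar> \<le> 3 / 2"
proof -
  have "(\<Sum>t. (1 / 3 :: real) ^ t) = 3 / 2"
    by (subst suminf_geometric) auto
  moreover have "cantor_code b \<le> (\<Sum>t. (1 / 3 :: real) ^ t)"
    unfolding cantor_code_def by (intro suminf_le summable_cantor_code) auto
  moreover have "0 \<le> cantor_code b"
    unfolding cantor_code_def by (intro suminf_nonneg summable_cantor_code) auto
  ultimately show ?thesis by simp
qed

text \<open>The first differing digit contributes \<open>(1 / 3) ^ t\<close>, and the later digits
  can cancel at most half of it.\<close>

lemma cantor_code_separation:
  assumes "\<And>s. s < t \<Longrightarrow> b s = b' s" and "b t \<noteq> b' t"
  shows "(1 / 3) ^ t / 2 \<le> \<bar>cantor_code b - cantor_code b'\<bar>"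
proof -
  define d where "d s = (of_bool (b s) - of_bool (b' s)) * (1 / 3 :: real) ^ s" for s
  have d: "\<bar>d s\<bar> \<le> (1 / 3) ^ s" for s by (auto simp: d_def)
  have sd: "summable d" unfolding d_def left_diff_distrib
    by (intro summable_diff summable_cantor_code)
  have "cantor_code b - cantor_code b' = suminf d"
    unfolding cantor_code_def d_def left_diff_distrib
    by (intro suminf_diff summable_cantor_code)
  also have "\<dots> = (\<Sum>s. d (s + Suc t)) + (\<Sum>s<Suc t. d s)"
    by (rule suminf_split_initial_segment[OF sd])
  also have "(\<Sum>s<Suc t. d s) = d t" using assms(1) by (simp add: d_def)
  finally have eq: "cantor_code b - cantor_code b' = (\<Sum>s. d (s + Suc t)) + d t" .
  have sg: "summable (\<lambda>s. (1 / 3 :: real) ^ Suc t * (1 / 3) ^ s)" by (intro summable_mult summable_geometric) simp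
  have "\<bar>\<Sum>s. d (s + Suc t)\<bar> \<le> (\<Sum>s. (1 / 3) ^ Suc t * (1 / 3) ^ s)"
  proof -
    have le: "\<bar>d (s + Suc t)\<bar> \<le> (1 / 3) ^ Suc t * (1 / 3) ^ s" for s
      using d[of "s + Suc t"] by (simp add: power_add mult_ac)
    then have sa: "summable (\<lambda>s. \<bar>d (s + Suc t)\<bar>)"
      by (intro summable_comparison_test'[OF sg, of 0]) simp
    show ?thesis
      using summable_rabs[OF sa] suminf_le[OF le sa sg] by simp
  qed
  also have "\<dots> = (1 / 3) ^ t / 2"
    by (subst suminf_mult) (auto simp: suminf_geometric)
  finally have "\<bar>\<Sum>s. d (s + Suc t)\<bar> \<le> (1 / 3) ^ t / 2" .
  moreover have "\<bar>d t\<bar> = (1 / 3) ^ t" using assms(2) by (auto simp: d_def)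
  ultimately show ?thesis unfolding eq by linarith
qed

text \<open>Codes closer than \<open>(1 / 3) ^ t / 2\<close> agree at every place up to
  \<open>t\<close>: a first difference at some \<open>s \<le> t\<close> would separate them by at
  least that much.\<close>

lemma cantor_code_convergent_imp_eventually_const:
  assumes "convergent (\<lambda>n. cantor_code (b n))"
  shows "\<exists>N. \<forall>i\<ge>N. \<forall>j\<ge>N. b i t = b j t"
proof -
  have "Cauchy (\<lambda>n. cantor_code (b n))" using assms by (rule convergent_Cauchy)
  then obtain N where N: "\<And>i j. i \<ge> N \<Longrightarrow> j \<ge> N \<Longrightarrow> \<bar>cantor_code (b i) - cantor_code (b j)\<bar> < (1 / 3) ^ t / 2"
    unfolding Cauchy_def dist_real_def by (metis divide_pos_pos zero_less_numeral zero_less_one zero_less_power)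
  have "b i t = b j t" if ij: "i \<ge> N" "j \<ge> N" for i j
  proof (rule ccontr)
    assume neq: "b i t \<noteq> b j t"
    define s where "s = (LEAST s. b i s \<noteq> b j s)"
    have "b i s \<noteq> b j s" "s \<le> t"
      unfolding s_def using neq by (fact LeastI[of "\<lambda>s. b i s \<noteq> b j s" t], fact Least_le[of "\<lambda>s. b i s \<noteq> b j s" t])
    moreover have "b i r = b j r" if "r < s" for r using not_less_Least that unfolding s_def by blast
    ultimately have "(1 / 3) ^ s / 2 \<le> \<bar>cantor_code (b i) - cantor_code (b j)\<bar>"
      by (intro cantor_code_separation)
    moreover have "(1 / 3 :: real) ^ t \<le> (1 / 3) ^ s" using \<open>s \<le> t\<close> by (intro power_decreasing) auto
    ultimately show False using N[OF ij] by linarith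
  qed
  then show ?thesis by blast
qed

text \<open>The minimum puts \<open>x = 1\<close> into the last cell, and \<open>nat\<close> sends
  negative \<open>x\<close> to cell 0. The index is thus monotone on the whole real line, where
  Helly's theorem is applied.\<close>

definition cell_index :: "nat \<Rightarrow> real \<Rightarrow> nat" where
  "cell_index N x = nat (min (int N - 1) \<lfloor>x * real N\<rfloor>)"

lemma cell_index_less: "0 < N \<Longrightarrow> cell_index N x < N"
  by (auto simp: cell_index_def min_def)

lemma mono_cell_index: "mono (cell_index N)"
  unfolding cell_index_def mono_def
  by (auto intro!: nat_mono min.mono floor_mono mult_right_mono)

text \<open>Cells are closed on the left, which gives the right-continuity that Helly's theorem
  demands of the step functions.\<close>

lemma cell_index_right_continuous: "\<forall>\<^sub>F y in at_right x. cell_index N y = cell_index N x"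
proof -
  have "((\<lambda>y. y * real N) \<longlongrightarrow> x * real N) (at_right x)" by (intro tendsto_intros)
  then have "\<forall>\<^sub>F y in at_right x. y * real N < real_of_int \<lfloor>x * real N\<rfloor> + 1"
    by (rule order_tendstoD(2)) linarith
  moreover have "\<forall>\<^sub>F y in at_right x. x < y" by (rule eventually_at_right_less)
  ultimately show ?thesis
  proof eventually_elim
    fix y assume y: "y * real N < real_of_int \<lfloor>x * real N\<rfloor> + 1" "x < y"
    have "x * real N \<le> y * real N" using y(2) by (intro mult_right_mono) auto
    then have "\<lfloor>y * real N\<rfloor> = \<lfloor>x * real N\<rfloor>" using y(1) by linarith
    then show "cell_index N y = cell_index N x" by (simp add: cell_index_def)
  qed
qed

lemma measurable_cell_index [measurable]: "cell_index N \<in> measurable borel (count_space UNIV)"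
  unfolding cell_index_def by measurable

text \<open>The cell lies between the half-open and the closed interval with ends
  \<open>i / N\<close> and \<open>(i + 1) / N\<close>. This covers the last cell, which contains its
  right end, without a case distinction.\<close>

lemma measure_cell_index:
  assumes "i < N"
  shows "measure unit_interval {x \<in> {0..1}. cell_index N x = i} = 1 / real N"
proof -
  let ?S = "{x \<in> {0..1}. cell_index N x = i}"
  have N: "real N > 0" using assms by simp
  have S: "?S \<in> sets lborel" by measurable
  have "measure unit_interval ?S = measure lborel ?S"
    by (rule measure_restrict_space) auto
  also have "\<dots> = 1 / real N"
  proof (rule antisym)
    have sub: "?S \<subseteq> {real i / real N .. (real i + 1) / real N}"
    proof
      fix x assume x: "x \<in> ?S"
      then have "0 \<le> x * real N" "x * real N \<le> real N" using mult_right_mono[of x 1 "real N"] by auto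
      then have "real i \<le> x * real N" "x * real N \<le> real i + 1"
        using x assms unfolding cell_index_def mem_Collect_eq by linarith+
      then show "x \<in> {real i / real N .. (real i + 1) / real N}" using N by (simp add: field_simps)
    qed
    have "measure lborel ?S \<le> measure lborel {real i / real N .. (real i + 1) / real N}"
      by (rule measure_mono_fmeasurable[OF sub S]) (rule fmeasurable_cbox[of "real i / real N" "(real i + 1) / real N", simplified])
    also have "\<dots> = 1 / real N" using N by (simp add: field_simps)
    finally show "measure lborel ?S \<le> 1 / real N" .
    have sub2: "{real i / real N ..< (real i + 1) / real N} \<subseteq> ?S"
    proof
      fix x assume "x \<in> {real i / real N ..< (real i + 1) / real N}"
      then have "real i \<le> x * real N" "x * real N < real i + 1" using N by (auto simp: field_simps)
      moreover from this have "\<lfloor>x * real N\<rfloor> = int i" by linarith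
      moreover have "0 \<le> x" using \<open>real i \<le> x * real N\<close> N by (metis mult_neg_pos not_less of_nat_0_le_iff order_le_less_trans)
      moreover have "x * real N \<le> 1 * real N" using \<open>x * real N < real i + 1\<close> assms by linarith
      ultimately show "x \<in> ?S" using assms N by (auto simp: cell_index_def)
    qed
    have "1 / real N = measure lborel {real i / real N ..< (real i + 1) / real N}" using N by (simp add: field_simps)
    also have "\<dots> \<le> measure lborel ?S"
    proof (rule measure_mono_fmeasurable[OF sub2])
      show "?S \<in> fmeasurable lborel"
        by (rule fmeasurableI2[of "{0..1}"]) (use S in \<open>auto intro: fmeasurable_cbox[of "0::real" 1, simplified]\<close>)
    qed auto
    finally show "1 / real N \<le> measure lborel ?S" .
  qed
  finally show ?thesis .
qed

text \<open>A uniformly random vertex, realised on the unit interval: \<open>v\<close> pushes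
  Lebesgue measure forward to the uniform distribution on \<open>V\<close>.\<close>

definition uniform_map :: "'a set \<Rightarrow> (real \<Rightarrow> 'a) \<Rightarrow> bool" where
  "uniform_map V v \<longleftrightarrow> v \<in> measurable unit_interval (count_space V) \<and>
     (\<forall>u\<in>V. measure unit_interval {x \<in> {0..1}. v x = u} = 1 / real (card V))"

lemma uniform_map_nth_cell_index:
  assumes "distinct xs" and "xs \<noteq> []"
  shows "uniform_map (set xs) (\<lambda>x. xs ! cell_index (length xs) x)"
  unfolding uniform_map_def
proof (intro conjI ballI)
  have lt: "cell_index (length xs) x < length xs" for x using assms(2) by (simp add: cell_index_less)
  have "cell_index (length xs) \<in> measurable unit_interval (count_space {..<length xs})"
    by (subst measurable_count_space_eq2)
       (use lt in \<open>auto simp: sets_restrict_space_iff space_restrict_space vimage_def Int_def cong: conj_cong\<close>)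
  then show "(\<lambda>x. xs ! cell_index (length xs) x) \<in> measurable unit_interval (count_space (set xs))"
    by (rule measurable_compose) auto
  fix u assume "u \<in> set xs"
  then obtain i where i: "i < length xs" "u = xs ! i" by (auto simp: in_set_conv_nth)
  then have "{x \<in> {0..1}. xs ! cell_index (length xs) x = u} = {x \<in> {0..1}. cell_index (length xs) x = i}"
    using lt assms(1) by (auto simp: nth_eq_iff_index_eq)
  then show "measure unit_interval {x \<in> {0..1}. xs ! cell_index (length xs) x = u} = 1 / real (card (set xs))"
    using i(1) assms(1) by (simp only: measure_cell_index distinct_card)
qed

text \<open>Listing the vertices of \<open>V n\<close> by increasing \<open>r n\<close> makes
  \<open>r n (v n x)\<close> monotone in \<open>x\<close>. Helly's theorem gives convergence at the
  continuity points of a monotone limit, hence outside a countable set.\<close>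

lemma helly_uniform_maps:
  fixes V :: "nat \<Rightarrow> 'a set" and r :: "nat \<Rightarrow> 'a \<Rightarrow> real"
  assumes V: "\<And>n. finite (V n)" "\<And>n. V n \<noteq> {}" and bound: "\<And>n u. \<bar>r n u\<bar> \<le> M"
  shows "\<exists>v s. strict_mono (s :: nat \<Rightarrow> nat) \<and> (\<forall>n. uniform_map (V n) (v n)) \<and>
     (AE x in unit_interval. convergent (\<lambda>n. r (s n) (v (s n) x)))"
proof -
  have "\<exists>xs. set xs = V n \<and> distinct xs \<and> sorted (map (r n) xs)" for n
  proof -
    obtain ys where "set ys = V n" "distinct ys" using finite_distinct_list[OF V(1)] by blast
    then show ?thesis by (intro exI[of _ "sort_key (r n) ys"]) auto
  qed
  then obtain xs where xs: "\<And>n. set (xs n) = V n" "\<And>n. distinct (xs n)" "\<And>n. sorted (map (r n) (xs n))"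
    by metis
  have ne: "xs n \<noteq> []" for n using xs(1) V(2) by (metis set_empty)
  then have lt: "cell_index (length (xs n)) x < length (xs n)" for n x by (simp add: cell_index_less)
  define v where "v n x = xs n ! cell_index (length (xs n)) x" for n x
  have unif: "uniform_map (V n) (v n)" for n
    using uniform_map_nth_cell_index[OF xs(2) ne] unfolding v_def xs(1) .
  have "\<exists>s. strict_mono (s :: nat \<Rightarrow> nat) \<and> (\<exists>F. (\<forall>x. continuous (at_right x) F) \<and> mono F \<and> (\<forall>x. \<bar>F x\<bar> \<le> M) \<and>
    (\<forall>x. continuous (at x) F \<longrightarrow> (\<lambda>n. r (s n) (v (s n) x)) \<longlonglongrightarrow> F x))"
  proof (rule Helly_selection)
    fix n x
    have "\<forall>\<^sub>F y in at_right x. r n (v n y) = r n (v n x)"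
      using cell_index_right_continuous[of "length (xs n)" x] by eventually_elim (simp add: v_def)
    then show "continuous (at_right x) (\<lambda>x. r n (v n x))"
      unfolding continuous_within by (rule tendsto_eventually)
    show "mono (\<lambda>x. r n (v n x))"
    proof (rule monoI)
      fix x y :: real assume "x \<le> y"
      then have "cell_index (length (xs n)) x \<le> cell_index (length (xs n)) y"
        by (rule monoD[OF mono_cell_index])
      then show "r n (v n x) \<le> r n (v n y)"
        using sorted_nth_mono[OF xs(3)[of n], of "cell_index (length (xs n)) x" "cell_index (length (xs n)) y"] lt[of n y] lt[of n x]
        by (simp add: v_def)
    qed
  qed (rule bound)
  then obtain s F where s: "strict_mono (s :: nat \<Rightarrow> nat)" and "mono F"
    and F: "\<And>x. isCont F x \<Longrightarrow> (\<lambda>n. r (s n) (v (s n) x)) \<longlonglongrightarrow> F x" by blast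
  have "{a. \<not> isCont F a} \<in> null_sets lborel"
    by (rule countable_imp_null_set_lborel[OF mono_ctble_discont[OF \<open>mono F\<close>]])
  then have "AE x in lborel. isCont F x"
    using AE_not_in by fastforce
  then have "AE x in unit_interval. convergent (\<lambda>n. r (s n) (v (s n) x))"
    by (subst AE_restrict_space_iff) (auto elim!: eventually_mono dest!: F simp: convergent_def)
  then show ?thesis using s unif by blast
qed

section \<open>Convergence to a random-free graphon\<close>

lemma prob_space_unit_interval: "prob_space unit_interval"
  by (rule prob_spaceI) (simp add: emeasure_restrict_space space_restrict_space)

interpretation unit: prob_space unit_interval by (rule prob_space_unit_interval)
interpretation unit2: pair_prob_space unit_interval unit_interval ..
interpretation units: product_prob_space "\<lambda>_ :: nat. unit_interval" UNIV ..

lemma space_unit_interval: "space unit_interval = {0..1}"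
  by (simp add: space_restrict_space)

lemma uniform_map_measurable: "uniform_map V v \<Longrightarrow> v \<in> measurable unit_interval (count_space V)"
  by (simp add: uniform_map_def)

lemma uniform_map_compose_measurable:
  "uniform_map V v \<Longrightarrow> (\<lambda>x. h (v x)) \<in> measurable unit_interval (count_space UNIV)"
  by (rule measurable_compose[OF uniform_map_measurable]) auto

lemma uniform_map_in: "uniform_map V v \<Longrightarrow> x \<in> {0..1} \<Longrightarrow> v x \<in> V"
  using measurable_space[OF uniform_map_measurable] space_unit_interval by auto

text \<open>As \<open>V\<close> is finite, the product of the two discrete measurable spaces on
  \<open>V\<close> is again discrete, so any relation \<open>R\<close> is admissible.\<close>

lemma uniform_map_pair_measurable:
  assumes "finite V" "uniform_map V v"
  shows "(\<lambda>z. R (v (fst z)) (v (snd z))) \<in> measurable (unit_interval \<Otimes>\<^sub>M unit_interval) (count_space UNIV)"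
proof -
  have "(\<lambda>z. (v (fst z), v (snd z))) \<in> measurable (unit_interval \<Otimes>\<^sub>M unit_interval) (count_space V \<Otimes>\<^sub>M count_space V)"
    using uniform_map_measurable[OF assms(2)] by measurable
  also have "count_space V \<Otimes>\<^sub>M count_space V = count_space (V \<times> V)"
    using assms(1) by (intro pair_measure_count_space) auto
  finally have "(\<lambda>z. (v (fst z), v (snd z))) \<in> measurable (unit_interval \<Otimes>\<^sub>M unit_interval) (count_space (V \<times> V))" .
  then have "(\<lambda>z. case_prod R (v (fst z), v (snd z))) \<in> measurable (unit_interval \<Otimes>\<^sub>M unit_interval) (count_space UNIV)"
    by (rule measurable_compose) auto
  then show ?thesis by simp
qed

section \<open>Vertex averages as integrals, and coordinates of product measures\<close>

lemma integral_uniform_map: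
  fixes h :: "'a \<Rightarrow> real"
  assumes "finite V" and "uniform_map V v"
  shows "(LINT x|unit_interval. h (v x)) = (\<Sum>u\<in>V. h u) / real (card V)"
proof -
  have sets: "{x \<in> {0..1}. v x = u} \<in> sets unit_interval" if "u \<in> V" for u
    using measurable_sets[OF uniform_map_measurable[OF assms(2)], of "{u}"] that
    by (simp add: space_unit_interval vimage_def Int_def conj_commute)
  have "(LINT x|unit_interval. h (v x)) = (LINT x|unit_interval. (\<Sum>u\<in>V. h u * indicator {x \<in> {0..1}. v x = u} x))"
    using assms by (intro Bochner_Integration.integral_cong)
      (auto simp: space_unit_interval indicator_def if_distrib uniform_map_in cong: if_cong)
  also have "\<dots> = (\<Sum>u\<in>V. h u * measure unit_interval {x \<in> {0..1}. v x = u})"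
  proof (subst Bochner_Integration.integral_sum)
    fix u assume "u \<in> V"
    then show "integrable unit_interval (\<lambda>x. h u * indicator {x \<in> {0..1}. v x = u} x)"
      using sets by (intro integrable_mult_right integrable_real_indicator) (auto simp: unit.emeasure_eq_measure)
  qed (auto simp: sets space_unit_interval Int_def intro!: sum.cong arg_cong[where f = "measure _"])
  also have "\<dots> = (\<Sum>u\<in>V. h u) / real (card V)"
    using assms(2) by (simp add: uniform_map_def sum_divide_distrib)
  finally show ?thesis .
qed

lemma integral_uniform_map_pair:
  fixes h :: "'a \<Rightarrow> 'a \<Rightarrow> real"
  assumes "finite V" and "uniform_map V v"
  shows "(LINT z|(unit_interval \<Otimes>\<^sub>M unit_interval). h (v (fst z)) (v (snd z))) =
     (\<Sum>(a, b)\<in>V \<times> V. h a b) / (real (card V))\<^sup>2"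
proof -
  have meas: "(\<lambda>z. h (v (fst z)) (v (snd z))) \<in> borel_measurable (unit_interval \<Otimes>\<^sub>M unit_interval)"
    by (rule measurable_compose[OF uniform_map_pair_measurable[OF assms, of h], of "\<lambda>r. r"]) simp
  \<comment> \<open>A crude uniform bound, which gives the integrability needed for Fubini's
    theorem.\<close>
  define B where "B = (\<Sum>(a, b)\<in>V \<times> V. \<bar>h a b\<bar>)"
  have "\<bar>h (v x) (v y)\<bar> \<le> B" if "x \<in> {0..1}" "y \<in> {0..1}" for x y
    unfolding B_def using member_le_sum[of "(v x, v y)" "V \<times> V" "\<lambda>(a, b). \<bar>h a b\<bar>"] that assms
    by (auto simp: uniform_map_in)
  then have int: "integrable (unit_interval \<Otimes>\<^sub>M unit_interval) (\<lambda>z. h (v (fst z)) (v (snd z)))"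
    using meas by (intro unit2.P.integrable_const_bound[where B = B]) (auto simp: space_pair_measure space_unit_interval)
  have "(LINT z|(unit_interval \<Otimes>\<^sub>M unit_interval). h (v (fst z)) (v (snd z))) =
      (LINT x|unit_interval. LINT y|unit_interval. h (v x) (v y))"
    using unit2.integral_fst'[OF int] by simp
  also have "\<dots> = (LINT x|unit_interval. (\<Sum>b\<in>V. h (v x) b) / real (card V))"
    by (simp add: integral_uniform_map[OF assms])
  also have "\<dots> = (\<Sum>a\<in>V. (\<Sum>b\<in>V. h a b) / real (card V)) / real (card V)"
    by (rule integral_uniform_map[OF assms])
  also have "\<dots> = (\<Sum>(a, b)\<in>V \<times> V. h a b) / (real (card V))\<^sup>2"
    by (simp add: sum_divide_distrib[symmetric] sum.cartesian_product power2_eq_square)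
  finally show ?thesis .
qed


text \<open>Two distinct coordinates of the product measure are independent, so their joint law is
  the product of the marginals; rectangles suffice to check this. With \<open>i = j\<close> the pair
  would lie on the diagonal, a null set.\<close>

lemma AE_PiM_pair:
  fixes i j :: nat
  assumes "finite I" "i \<in> I" "j \<in> I" "i \<noteq> j" and "AE z in unit_interval \<Otimes>\<^sub>M unit_interval. Q (fst z) (snd z)"
  shows "AE x in PiM I (\<lambda>_. unit_interval). Q (x i) (x j)"
proof -
  let ?P = "PiM I (\<lambda>_. unit_interval)"
  have meas: "(\<lambda>x. (x i, x j)) \<in> measurable ?P (unit_interval \<Otimes>\<^sub>M unit_interval)"
    using assms(2,3) by measurable
  have eq: "unit_interval \<Otimes>\<^sub>M unit_interval = distr ?P (unit_interval \<Otimes>\<^sub>M unit_interval) (\<lambda>x. (x i, x j))"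
  proof (rule pair_measure_eqI)
    fix A B assume AB: "A \<in> sets unit_interval" "B \<in> sets unit_interval"
    define X where "X l = (if l = i then A else if l = j then B else space unit_interval)" for l
    have X: "X l \<in> sets unit_interval" for l using AB sets.top[of unit_interval] unfolding X_def by presburger
    have "(\<lambda>x. (x i, x j)) -` (A \<times> B) \<inter> space ?P = Pi\<^sub>E I X"
    proof -
      have "A \<subseteq> space unit_interval" "B \<subseteq> space unit_interval" using sets.sets_into_space[OF AB(1)] sets.sets_into_space[OF AB(2)] .
      then show ?thesis using assms(2-4) by (auto simp: space_PiM PiE_iff X_def split: if_splits simp del: space_restrict_space2) (metis subsetD)+
    qed
    then have "emeasure (distr ?P (unit_interval \<Otimes>\<^sub>M unit_interval) (\<lambda>x. (x i, x j))) (A \<times> B) = emeasure ?P (Pi\<^sub>E I X)"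
      using AB by (simp add: emeasure_distr[OF meas] del: sets_restrict_space_iff)
    also have "\<dots> = (\<Prod>l\<in>I. emeasure unit_interval (X l))"
      by (rule units.emeasure_PiM[OF assms(1) X])
    also have "\<dots> = (\<Prod>l\<in>{i, j}. emeasure unit_interval (X l))"
      using assms(1-3) by (intro prod.mono_neutral_right) (auto simp: X_def unit.emeasure_space_1[unfolded space_unit_interval])
    also have "\<dots> = emeasure unit_interval A * emeasure unit_interval B"
      using assms(4) by (simp add: X_def)
    finally show "emeasure unit_interval A * emeasure unit_interval B =
        emeasure (distr ?P (unit_interval \<Otimes>\<^sub>M unit_interval) (\<lambda>x. (x i, x j))) (A \<times> B)" ..
  qed (auto intro: unit.sigma_finite_measure_axioms)
  have "AE z in distr ?P (unit_interval \<Otimes>\<^sub>M unit_interval) (\<lambda>x. (x i, x j)). Q (fst z) (snd z)"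
    using assms(5) unfolding eq[symmetric] .
  from AE_distrD[OF meas this] show ?thesis by simp
qed

lemma prod_of_bool:
  "finite A \<Longrightarrow> (\<Prod>a\<in>A. of_bool (P a)) = (of_bool (\<forall>a\<in>A. P a) :: 'b::comm_semiring_1)"
  by (induction A rule: finite_induct) auto

lemma AE_unit_pair_fst:
  assumes "AE x in unit_interval. Q x"
  shows "AE z in unit_interval \<Otimes>\<^sub>M unit_interval. Q (fst z)"
  by (rule AE_distrD[OF measurable_fst]) (simp only: unit.distr_pair_fst assms)

lemma AE_unit_pair_snd:
  assumes "AE x in unit_interval. Q x"
  shows "AE z in unit_interval \<Otimes>\<^sub>M unit_interval. Q (snd z)"
proof -
  let ?S = "unit_interval \<Otimes>\<^sub>M unit_interval"
  have "AE z in distr ?S ?S (\<lambda>(x, y). (y, x)). Q (fst z)"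
    unfolding unit2.distr_pair_swap[symmetric] by (rule AE_unit_pair_fst[OF assms])
  then have "AE z in ?S. Q (fst ((\<lambda>(x, y). (y, x)) z))"
    by (rule AE_distrD[rotated]) measurable
  then show ?thesis by (simp add: case_prod_unfold)
qed

definition pulled_back_graphon :: "'a pair_pre_digraph \<Rightarrow> (real \<Rightarrow> 'a) \<Rightarrow> real \<Rightarrow> real \<Rightarrow> real" where
  "pulled_back_graphon G v x y = of_bool ((v x, v y) \<in> parcs G)"

text \<open>Independent uniform points \<open>x i\<close> give a uniformly random map
  \<open>v (x i)\<close> into the vertices of \<open>G\<close>, and the integrand is the indicator
  that this map is a homomorphism. Written as a sum over homomorphisms, it becomes a sum of products
  over coordinates, which integrate factor by factor.\<close>

lemma graphon_density_pulled_back: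
  fixes F :: "nat pair_pre_digraph" and G :: "'a pair_pre_digraph"
  assumes F: "pair_graph F" and G: "pair_graph G" and v: "uniform_map (pverts G) v"
  shows "graphon_density F (pulled_back_graphon G v) = hom_density F G"
proof -
  interpret F: pair_graph F by fact
  interpret G: pair_graph G by fact
  let ?I = "pverts F"
  have finI: "finite ?I" and finE: "finite (parcs F)" and finV: "finite (pverts G)" by auto
  have finh: "finite (homs F G)"
    unfolding homs_def by (rule finite_subset[of _ "?I \<rightarrow>\<^sub>E pverts G"]) (use finI finV in \<open>auto intro: finite_PiE\<close>)
  have pointwise: "(\<Prod>(i, j)\<in>{(i, j) \<in> parcs F. i < j}. pulled_back_graphon G v (x i) (x j)) =
      (\<Sum>f\<in>homs F G. \<Prod>i\<in>?I. of_bool (v (x i) = f i))" if x: "x \<in> space (PiM ?I (\<lambda>_. unit_interval))" for x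
  proof -
    define g where "g = (\<lambda>i\<in>?I. v (x i))"
    have g: "g \<in> ?I \<rightarrow>\<^sub>E pverts G"
    proof -
      have "x i \<in> {0..1}" if "i \<in> ?I" for i
        using PiE_mem[of x ?I "\<lambda>_. {0..1}" i] x that by (simp only: space_PiM space_unit_interval)
      then show ?thesis using uniform_map_in[OF v] by (auto simp: g_def)
    qed
    \<comment> \<open>The arcs with \<open>i < j\<close> suffice because both arc sets are symmetric
      and \<open>F\<close> has no loops.\<close>
    have "(\<forall>(i, j)\<in>{(i, j) \<in> parcs F. i < j}. (v (x i), v (x j)) \<in> parcs G) \<longleftrightarrow> (\<forall>(i, j)\<in>parcs F. (g i, g j) \<in> parcs G)" (is "?L \<longleftrightarrow> ?R")
    proof -
      have *: "i \<in> ?I \<and> j \<in> ?I \<and> i \<noteq> j \<and> (j, i) \<in> parcs F" if "(i, j) \<in> parcs F" for i j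
        using F.arcs_symmetric[OF that] F.in_arcsD1[OF that] F.in_arcsD2[OF that] F.no_loops'[of i] that by metis
      have "(g i, g j) \<in> parcs G"
        if "\<forall>(i, j)\<in>{(i, j) \<in> parcs F. i < j}. (v (x i), v (x j)) \<in> parcs G" and ij: "(i, j) \<in> parcs F" for i j
      proof (cases "i < j")
        case True
        then show ?thesis using that *[OF ij] by (auto simp: g_def)
      next
        case False
        then have "j < i" using *[OF ij] by simp
        then have "(v (x j), v (x i)) \<in> parcs G" using that *[OF ij] by auto
        then show ?thesis using G.arcs_symmetric *[OF ij] by (simp add: g_def)
      qed
      moreover have "(v (x i), v (x j)) \<in> parcs G"
        if "\<forall>(i, j)\<in>parcs F. (g i, g j) \<in> parcs G" and ij: "(i, j) \<in> parcs F" for i j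
      proof -
        have "(g i, g j) \<in> parcs G" using that by blast
        then show ?thesis using *[OF ij] by (simp add: g_def)
      qed
      ultimately show ?thesis by blast
    qed
    then have "(\<Prod>(i, j)\<in>{(i, j) \<in> parcs F. i < j}. pulled_back_graphon G v (x i) (x j)) = of_bool (g \<in> homs F G)"
    proof -
      assume *: "?L \<longleftrightarrow> ?R"
      have "finite {(i, j) \<in> parcs F. i < j}" by (rule finite_subset[OF _ finE]) auto
      then have "(\<Prod>(i, j)\<in>{(i, j) \<in> parcs F. i < j}. pulled_back_graphon G v (x i) (x j)) = of_bool ?L"
        unfolding pulled_back_graphon_def case_prod_unfold by (rule prod_of_bool)
      then show ?thesis using g unfolding * homs_def by simp
    qed
    also have "\<dots> = (\<Sum>f\<in>homs F G. of_bool (g = f))"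
      using finh by (simp add: of_bool_def)
    also have "\<dots> = (\<Sum>f\<in>homs F G. \<Prod>i\<in>?I. of_bool (v (x i) = f i))"
    proof (rule sum.cong[OF refl])
      fix f assume f: "f \<in> homs F G"
      then have "g = f \<longleftrightarrow> (\<forall>i\<in>?I. v (x i) = f i)"
        unfolding homs_def g_def by (auto simp: PiE_iff extensional_def fun_eq_iff)
      then show "of_bool (g = f) = (\<Prod>i\<in>?I. of_bool (v (x i) = f i) :: real)"
        by (simp only: prod_of_bool[OF finI])
    qed
    finally show ?thesis .
  qed
  have int: "integrable unit_interval (\<lambda>x. of_bool (v x = a) :: real)" for a
    by (intro unit.integrable_const_bound[where B = 1]
         measurable_compose[OF uniform_map_compose_measurable[OF v, of "\<lambda>b. of_bool (b = a) :: real"], of "\<lambda>r. r"]) auto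
  have "graphon_density F (pulled_back_graphon G v) =
      (LINT x | PiM ?I (\<lambda>_. unit_interval). (\<Sum>f\<in>homs F G. \<Prod>i\<in>?I. of_bool (v (x i) = f i)))"
    unfolding graphon_density_def by (rule Bochner_Integration.integral_cong[OF refl pointwise])
  also have "\<dots> = (\<Sum>f\<in>homs F G. (LINT x | PiM ?I (\<lambda>_. unit_interval). (\<Prod>i\<in>?I. of_bool (v (x i) = f i))))"
    by (rule Bochner_Integration.integral_sum) (rule units.product_integrable_prod[OF finI int])
  also have "\<dots> = (\<Sum>f\<in>homs F G. \<Prod>i\<in>?I. (LINT x | unit_interval. of_bool (v x = f i)))"
    by (intro sum.cong refl units.product_integral_prod[OF finI int])
  also have "\<dots> = (\<Sum>f\<in>homs F G. \<Prod>i\<in>?I. 1 / real (card (pverts G)))"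
  proof (intro sum.cong prod.cong refl)
    fix f i assume "f \<in> homs F G" "i \<in> ?I"
    then have "f i \<in> pverts G" by (auto simp: homs_def)
    then show "(LINT x | unit_interval. of_bool (v x = f i)) = 1 / real (card (pverts G))"
      using integral_uniform_map[OF finV v, of "\<lambda>a. of_bool (a = f i)"] finV by (simp add: of_bool_def)
  qed
  also have "\<dots> = hom_density F G"
    by (simp add: hom_density_def power_divide)
  finally show ?thesis .
qed

text \<open>Dominated convergence with bound 1. The limit is taken as the lower limit of the
  predicates, which is measurable and equals the eventual value wherever there is one.\<close>

lemma eventually_const_L1_tendsto:
  assumes "prob_space M" and p: "\<And>n. Measurable.pred M (p n)"
    and const: "AE z in M. \<exists>N. \<forall>i\<ge>N. \<forall>j\<ge>N. p i z = p j z"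
  shows "(\<lambda>n. LINT z|M. \<bar>of_bool (p n z) - of_bool (\<exists>N::nat. \<forall>i\<ge>N. p i z)\<bar> :: real) \<longlonglongrightarrow> 0"
proof -
  interpret prob_space M by fact
  note p [measurable]
  have "(\<lambda>n. LINT z|M. \<bar>of_bool (p n z) - of_bool (\<exists>N. \<forall>i\<ge>N. p i z)\<bar> :: real) \<longlonglongrightarrow> (LINT z|M. 0)"
  proof (rule integral_dominated_convergence[where w = "\<lambda>_. 1"])
    show "AE z in M. (\<lambda>n. \<bar>of_bool (p n z) - of_bool (\<exists>N. \<forall>i\<ge>N. p i z)\<bar> :: real) \<longlonglongrightarrow> 0"
      using const
    proof eventually_elim
      fix z assume "\<exists>N. \<forall>i\<ge>N. \<forall>j\<ge>N. p i z = p j z"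
      then obtain N where N: "\<And>i j. i \<ge> N \<Longrightarrow> j \<ge> N \<Longrightarrow> p i z = p j z" by blast
      have "p n z \<longleftrightarrow> (\<exists>N. \<forall>i\<ge>N. p i z)" if "n \<ge> N" for n
        using N[OF that] by (meson nle_le)
      then have "\<forall>\<^sub>F n in sequentially. \<bar>of_bool (p n z) - of_bool (\<exists>N. \<forall>i\<ge>N. p i z)\<bar> = (0 :: real)"
        unfolding eventually_sequentially by (intro exI[of _ N]) simp
      then show "(\<lambda>n. \<bar>of_bool (p n z) - of_bool (\<exists>N. \<forall>i\<ge>N. p i z)\<bar> :: real) \<longlonglongrightarrow> 0"
        by (rule tendsto_eventually)
    qed
  qed (auto simp: of_bool_def)
  then show ?thesis by simp
qed

text \<open>The label sequence of a vertex is coded by a real number, in such a way that convergence of the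
  codes makes every single label eventually constant. Ordering the vertices by their codes turns
  the codes into monotone step functions on the unit interval, to which Helly's theorem applies.\<close>

lemma exists_convergent_uniform_maps:
  fixes V :: "nat \<Rightarrow> 'a set" and Lab :: "nat \<Rightarrow> 'l set" and c :: "nat \<Rightarrow> nat \<Rightarrow> 'a \<Rightarrow> 'l"
  assumes V: "\<And>n. finite (V n)" "\<And>n. V n \<noteq> {}" and Lab: "\<And>k. finite (Lab k)"
    and c: "\<And>k. \<forall>\<^sub>F n in sequentially. c k n \<in> V n \<rightarrow> Lab k"
  shows "\<exists>v s. strict_mono (s :: nat \<Rightarrow> nat) \<and> (\<forall>n. uniform_map (V n) (v n)) \<and>
     (AE x in unit_interval. \<forall>k. \<exists>N. \<forall>i\<ge>N. \<forall>j\<ge>N. c k (s i) (v (s i) x) = c k (s j) (v (s j) x))"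
proof -
  have "\<exists>f. inj_on f (Lab k) \<and> (\<exists>M::nat. f ` Lab k \<subseteq> {..<M})" for k
    using finite_imp_inj_to_nat_seg[OF Lab[of k]] by (metis lessThan_def order_refl)
  then obtain f M where f: "\<And>k. inj_on (f k) (Lab k)" and M: "\<And>k. f k ` Lab k \<subseteq> {..<M k :: nat}"
    by metis
  \<comment> \<open>One bit sequence stores all labels of \<open>u\<close>: the bit at
    \<open>prod_encode (k, l)\<close> says whether the \<open>k\<close>-th label has number
    \<open>l\<close>.\<close>
  define b where "b n u t = (case prod_decode t of (k, l) \<Rightarrow> f k (c k n u) = l)" for n u t
  obtain v s where s: "strict_mono (s :: nat \<Rightarrow> nat)" and v: "\<And>n. uniform_map (V n) (v n)"
    and conv: "AE x in unit_interval. convergent (\<lambda>n. cantor_code (b (s n) (v (s n) x)))"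
    using helly_uniform_maps[of V "\<lambda>n u. cantor_code (b n u)" "3 / 2", OF V cantor_code_bounds] by blast
  have "AE x in unit_interval. \<forall>k. \<exists>N. \<forall>i\<ge>N. \<forall>j\<ge>N. c k (s i) (v (s i) x) = c k (s j) (v (s j) x)"
    using conv AE_space
  proof eventually_elim
    fix x assume conv: "convergent (\<lambda>n. cantor_code (b (s n) (v (s n) x)))" and x: "x \<in> space unit_interval"
    show "\<forall>k. \<exists>N. \<forall>i\<ge>N. \<forall>j\<ge>N. c k (s i) (v (s i) x) = c k (s j) (v (s j) x)"
    proof
      fix k
      let ?c = "\<lambda>i. c k (s i) (v (s i) x)"
      obtain N0 where N0: "\<And>n. n \<ge> N0 \<Longrightarrow> c k n \<in> V n \<rightarrow> Lab k"
        using c[of k] unfolding eventually_sequentially by blast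
      have inLab: "?c i \<in> Lab k" if "i \<ge> N0" for i
      proof -
        have "s i \<ge> N0" using seq_suble[OF s, of i] that by linarith
        then show ?thesis using N0 uniform_map_in[OF v] x by (auto simp: space_unit_interval)
      qed
      have "\<forall>l. \<exists>N. \<forall>i\<ge>N. \<forall>j\<ge>N. b (s i) (v (s i) x) (prod_encode (k, l)) = b (s j) (v (s j) x) (prod_encode (k, l))"
        using cantor_code_convergent_imp_eventually_const[OF conv] by blast
      then obtain N where N: "\<And>l i j. i \<ge> N l \<Longrightarrow> j \<ge> N l \<Longrightarrow> (f k (?c i) = l) = (f k (?c j) = l)"
        unfolding b_def by (simp only: prod_encode_inverse prod.case) metis
      \<comment> \<open>Only numbers below \<open>M k\<close> occur as labels, so finitely many
        thresholds matter; inserting 0 keeps the maximum defined when there are none.\<close>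
      define K where "K = max N0 (Max (insert 0 (N ` {..<M k})))"
      have K: "N l \<le> K" if "l < M k" for l
        unfolding K_def using that by (intro max.coboundedI2 Max_ge) auto
      have "?c i = ?c j" if "i \<ge> K" "j \<ge> K" for i j
      proof -
        have L: "?c i \<in> Lab k" "?c j \<in> Lab k" using that inLab by (auto simp: K_def)
        then have "f k (?c i) < M k" using M by blast
        then have "f k (?c j) = f k (?c i)" using N[of "f k (?c i)" i j] K[of "f k (?c i)"] that by simp
        then show ?thesis using inj_onD[OF f _ L(1) L(2)] by simp
      qed
      then show "\<exists>N. \<forall>i\<ge>N. \<forall>j\<ge>N. ?c i = ?c j" by blast
    qed
  qed
  then show ?thesis using s v by blast
qed

section \<open>Subsequential limits of approximately labelled graphs\<close>

lemma pulled_back_graphon_measurable: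
  assumes "pair_graph G" "uniform_map (pverts G) v"
  shows "Measurable.pred (unit_interval \<Otimes>\<^sub>M unit_interval) (\<lambda>z. (v (fst z), v (snd z)) \<in> parcs G)"
proof -
  interpret pair_graph G by fact
  show ?thesis
    by (rule uniform_map_pair_measurable[OF _ assms(2), of "\<lambda>a b. (a, b) \<in> parcs G"]) auto
qed

text \<open>The predicted adjacency \<open>p k n\<close> is eventually constant almost everywhere
  and differs from the true adjacency \<open>e n\<close> by at most \<open>\<epsilon> k\<close> in
  mean for large \<open>n\<close>. So the \<open>e n\<close> form a Cauchy sequence of 0/1-valued
  functions, and an almost everywhere limit of a subsequence is again 0/1-valued.\<close>

lemma labelled_graphs_subseq_converge:
  fixes G :: "nat \<Rightarrow> 'a pair_pre_digraph"
  assumes G: "\<And>n. pair_graph (G n)" and ne: "\<And>n. pverts (G n) \<noteq> {}"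
    and approx: "\<And>\<epsilon>. 0 < \<epsilon> \<Longrightarrow> \<exists>(Lab :: 'l set) H. finite Lab \<and> (\<forall>\<^sub>F n in sequentially. \<exists>c \<in> pverts (G n) \<rightarrow> Lab.
       real (card {(u, v) \<in> pverts (G n) \<times> pverts (G n). ((u, v) \<in> parcs (G n)) \<noteq> H (c u) (c v)}) \<le> \<epsilon> * (real (card (pverts (G n))))\<^sup>2)"
  shows "\<exists>W s. graphon W \<and> random_free W \<and> strict_mono (s :: nat \<Rightarrow> nat) \<and> converges_to_graphon (G \<circ> s) W"
proof -
  let ?S = "unit_interval \<Otimes>\<^sub>M unit_interval"
  let ?V = "\<lambda>n. pverts (G n)"
  have finV: "finite (?V n)" for n 
  proof -
    interpret pair_graph "G n" by (rule G)
    show ?thesis by auto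
  qed
  define \<epsilon> where "\<epsilon> k = 1 / real (Suc k)" for k
  have "\<forall>k. \<exists>(Lab :: 'l set) H c. finite Lab \<and> (\<forall>\<^sub>F n in sequentially. c n \<in> ?V n \<rightarrow> Lab \<and>
     real (card {(u, v) \<in> ?V n \<times> ?V n. ((u, v) \<in> parcs (G n)) \<noteq> H (c n u) (c n v)}) \<le> \<epsilon> k * (real (card (?V n)))\<^sup>2)"
  proof
    fix k
    obtain Lab :: "'l set" and H where "finite Lab" and *: "\<forall>\<^sub>F n in sequentially. \<exists>c \<in> ?V n \<rightarrow> Lab.
       real (card {(u, v) \<in> ?V n \<times> ?V n. ((u, v) \<in> parcs (G n)) \<noteq> H (c u) (c v)}) \<le> \<epsilon> k * (real (card (?V n)))\<^sup>2"
      using approx[of "\<epsilon> k"] by (auto simp: \<epsilon>_def)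
    define Q where "Q n c \<longleftrightarrow> c \<in> ?V n \<rightarrow> Lab \<and>
      real (card {(u, v) \<in> ?V n \<times> ?V n. ((u, v) \<in> parcs (G n)) \<noteq> H (c u) (c v)}) \<le> \<epsilon> k * (real (card (?V n)))\<^sup>2" for n c
    define c where "c n = (SOME c. Q n c)" for n
    have "\<forall>\<^sub>F n in sequentially. \<exists>c. Q n c"
      using * unfolding Bex_def Q_def .
    then have "\<forall>\<^sub>F n in sequentially. Q n (c n)"
      unfolding c_def by eventually_elim (erule someI_ex)
    then have "\<forall>\<^sub>F n in sequentially. c n \<in> ?V n \<rightarrow> Lab \<and>
     real (card {(u, v) \<in> ?V n \<times> ?V n. ((u, v) \<in> parcs (G n)) \<noteq> H (c n u) (c n v)}) \<le> \<epsilon> k * (real (card (?V n)))\<^sup>2"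
      unfolding Q_def .
    then show "\<exists>(Lab :: 'l set) H c. finite Lab \<and> (\<forall>\<^sub>F n in sequentially. c n \<in> ?V n \<rightarrow> Lab \<and>
     real (card {(u, v) \<in> ?V n \<times> ?V n. ((u, v) \<in> parcs (G n)) \<noteq> H (c n u) (c n v)}) \<le> \<epsilon> k * (real (card (?V n)))\<^sup>2)"
      using \<open>finite Lab\<close> by blast
  qed
  then obtain Lab :: "nat \<Rightarrow> 'l set" and H c where Lab: "\<And>k. finite (Lab k)"
    and c: "\<And>k. \<forall>\<^sub>F n in sequentially. c k n \<in> ?V n \<rightarrow> Lab k \<and>
     real (card {(u, v) \<in> ?V n \<times> ?V n. ((u, v) \<in> parcs (G n)) \<noteq> H k (c k n u) (c k n v)}) \<le> \<epsilon> k * (real (card (?V n)))\<^sup>2"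
    unfolding choice_iff by blast
  have c1: "\<forall>\<^sub>F n in sequentially. c k n \<in> ?V n \<rightarrow> Lab k" for k
    using c[of k] by eventually_elim blast
  \<comment> \<open>One vertex ordering and one subsequence serve all accuracies \<open>k\<close>
    simultaneously.\<close>
  obtain v s where s: "strict_mono (s :: nat \<Rightarrow> nat)" and v: "\<And>n. uniform_map (?V n) (v n)"
    and const: "AE x in unit_interval. \<forall>k. \<exists>N. \<forall>i\<ge>N. \<forall>j\<ge>N. c k (s i) (v (s i) x) = c k (s j) (v (s j) x)"
    using exists_convergent_uniform_maps[of ?V Lab c, OF finV ne Lab c1] by blast
  define e where "e n z \<longleftrightarrow> (v (s n) (fst z), v (s n) (snd z)) \<in> parcs (G (s n))" for n z
  define p where "p k n z \<longleftrightarrow> H k (c k (s n) (v (s n) (fst z))) (c k (s n) (v (s n) (snd z)))" for k n z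
  have e_meas [measurable]: "Measurable.pred ?S (e n)" for n
    unfolding e_def by (rule pulled_back_graphon_measurable[OF G v])
  have p_meas [measurable]: "Measurable.pred ?S (p k n)" for k n
    unfolding p_def by (rule uniform_map_pair_measurable[OF finV v, of "\<lambda>a b. H k (c k (s n) a) (c k (s n) b)" "s n"])
  define q where "q k z \<longleftrightarrow> (\<exists>N. \<forall>i\<ge>N. p k i z)" for k z
  have q_meas [measurable]: "Measurable.pred ?S (q k)" for k
    unfolding q_def by measurable
  have constfst: "AE z in ?S. \<forall>k. \<exists>N. \<forall>i\<ge>N. \<forall>j\<ge>N. c k (s i) (v (s i) (fst z)) = c k (s j) (v (s j) (fst z))"
    by (rule AE_unit_pair_fst[OF const])
  have constsnd: "AE z in ?S. \<forall>k. \<exists>N. \<forall>i\<ge>N. \<forall>j\<ge>N. c k (s i) (v (s i) (snd z)) = c k (s j) (v (s j) (snd z))"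
    by (rule AE_unit_pair_snd[OF const])
  have p_const: "AE z in ?S. \<exists>N. \<forall>i\<ge>N. \<forall>j\<ge>N. p k i z = p k j z" for k
    using constfst constsnd
  proof eventually_elim
    fix z
    assume "\<forall>k. \<exists>N. \<forall>i\<ge>N. \<forall>j\<ge>N. c k (s i) (v (s i) (fst z)) = c k (s j) (v (s j) (fst z))"
      and "\<forall>k. \<exists>N. \<forall>i\<ge>N. \<forall>j\<ge>N. c k (s i) (v (s i) (snd z)) = c k (s j) (v (s j) (snd z))"
    then obtain N N' where N: "\<forall>i\<ge>N. \<forall>j\<ge>N. c k (s i) (v (s i) (fst z)) = c k (s j) (v (s j) (fst z))"
      and N': "\<forall>i\<ge>N'. \<forall>j\<ge>N'. c k (s i) (v (s i) (snd z)) = c k (s j) (v (s j) (snd z))" by blast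
    have "p k i z = p k j z" if "i \<ge> max N N'" "j \<ge> max N N'" for i j
    proof -
      have "c k (s i) (v (s i) (fst z)) = c k (s j) (v (s j) (fst z))" "c k (s i) (v (s i) (snd z)) = c k (s j) (v (s j) (snd z))"
        using N N' that by auto
      then show ?thesis by (simp add: p_def)
    qed
    then show "\<exists>N. \<forall>i\<ge>N. \<forall>j\<ge>N. p k i z = p k j z" by blast
  qed
  have int: "integrable ?S (\<lambda>z. \<bar>of_bool (a z) - of_bool (b z)\<bar> :: real)"
    if [measurable]: "Measurable.pred ?S a" "Measurable.pred ?S b" for a b
    by (rule unit2.P.integrable_const_bound[where B = 1]) (auto simp: of_bool_def)
  have pe: "\<forall>\<^sub>F n in sequentially. (LINT z|?S. \<bar>of_bool (e n z) - of_bool (p k n z)\<bar> :: real) \<le> \<epsilon> k" for k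
  proof -
    have "\<forall>\<^sub>F n in sequentially. real (card {(u, w) \<in> ?V (s n) \<times> ?V (s n). ((u, w) \<in> parcs (G (s n))) \<noteq> H k (c k (s n) u) (c k (s n) w)}) \<le> \<epsilon> k * (real (card (?V (s n))))\<^sup>2"
      using eventually_compose_filterlim[OF c[of k] filterlim_subseq[OF s]] by eventually_elim blast
    then show ?thesis
    proof eventually_elim
      fix n
      let ?h = "\<lambda>u w. \<bar>of_bool ((u, w) \<in> parcs (G (s n))) - of_bool (H k (c k (s n) u) (c k (s n) w))\<bar> :: real"
      let ?B = "{(u, w) \<in> ?V (s n) \<times> ?V (s n). ((u, w) \<in> parcs (G (s n))) \<noteq> H k (c k (s n) u) (c k (s n) w)}"
      assume le: "real (card ?B) \<le> \<epsilon> k * (real (card (?V (s n))))\<^sup>2"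
      have "(LINT z|?S. \<bar>of_bool (e n z) - of_bool (p k n z)\<bar> :: real) = (\<Sum>(u, w)\<in>?V (s n) \<times> ?V (s n). ?h u w) / (real (card (?V (s n))))\<^sup>2"
        unfolding e_def p_def by (rule integral_uniform_map_pair[OF finV v, of ?h])
      also have "(\<Sum>(u, w)\<in>?V (s n) \<times> ?V (s n). ?h u w) = (\<Sum>z\<in>?V (s n) \<times> ?V (s n). of_bool (z \<in> ?B))"
        by (intro sum.cong) (auto simp: of_bool_def split: if_splits)
      also have "\<dots> = real (card ?B)"
        using finV by (simp add: Int_def mem_Times_iff case_prod_unfold conj_assoc)
      also have "real (card ?B) / (real (card (?V (s n))))\<^sup>2 \<le> \<epsilon> k"
        using le ne finV by (simp add: divide_le_eq card_gt_0_iff)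
      finally show "(LINT z|?S. \<bar>of_bool (e n z) - of_bool (p k n z)\<bar> :: real) \<le> \<epsilon> k" .
    qed
  qed
  have cauchy: "\<exists>N. \<forall>i\<ge>N. \<forall>j\<ge>N. (LINT z|?S. norm (of_bool (e i z) - of_bool (e j z) :: real)) < \<eta>" if "\<eta> > 0" for \<eta>
  proof -
    obtain k where k: "\<epsilon> k < \<eta> / 4"
      using reals_Archimedean[of "\<eta> / 4"] \<open>\<eta> > 0\<close> unfolding \<epsilon>_def by (auto simp: inverse_eq_divide)
    have "(\<lambda>n. LINT z|?S. \<bar>of_bool (p k n z) - of_bool (q k z)\<bar> :: real) \<longlonglongrightarrow> 0"
      unfolding q_def by (rule eventually_const_L1_tendsto[OF unit2.P.prob_space_axioms p_meas p_const])
    then have "\<forall>\<^sub>F n in sequentially. (LINT z|?S. \<bar>of_bool (p k n z) - of_bool (q k z)\<bar> :: real) < \<eta> / 4"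
      using \<open>\<eta> > 0\<close> by (intro order_tendstoD(2)) auto
    with pe[of k] have "\<forall>\<^sub>F n in sequentially. (LINT z|?S. \<bar>of_bool (e n z) - of_bool (q k z)\<bar> :: real) < \<eta> / 2"
    proof eventually_elim
      fix n
      assume 1: "(LINT z|?S. \<bar>of_bool (e n z) - of_bool (p k n z)\<bar> :: real) \<le> \<epsilon> k"
        and 2: "(LINT z|?S. \<bar>of_bool (p k n z) - of_bool (q k z)\<bar> :: real) < \<eta> / 4"
      have "(LINT z|?S. \<bar>of_bool (e n z) - of_bool (q k z)\<bar> :: real) \<le>
        (LINT z|?S. \<bar>of_bool (e n z) - of_bool (p k n z)\<bar> + \<bar>of_bool (p k n z) - of_bool (q k z)\<bar>)"
        by (intro integral_mono Bochner_Integration.integrable_add int e_meas p_meas q_meas) (auto simp: of_bool_def)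
      also have "\<dots> = (LINT z|?S. \<bar>of_bool (e n z) - of_bool (p k n z)\<bar>) + (LINT z|?S. \<bar>of_bool (p k n z) - of_bool (q k z)\<bar>)"
        by (intro Bochner_Integration.integral_add int e_meas p_meas q_meas)
      finally show "(LINT z|?S. \<bar>of_bool (e n z) - of_bool (q k z)\<bar> :: real) < \<eta> / 2"
        using 1 2 k by linarith
    qed
    then obtain N where N: "\<And>n. n \<ge> N \<Longrightarrow> (LINT z|?S. \<bar>of_bool (e n z) - of_bool (q k z)\<bar> :: real) < \<eta> / 2"
      unfolding eventually_sequentially by blast
    have "(LINT z|?S. norm (of_bool (e i z) - of_bool (e j z) :: real)) < \<eta>" if "i \<ge> N" "j \<ge> N" for i j
    proof -
      have "(LINT z|?S. norm (of_bool (e i z) - of_bool (e j z) :: real)) \<le>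
        (LINT z|?S. \<bar>of_bool (e i z) - of_bool (q k z)\<bar> + \<bar>of_bool (e j z) - of_bool (q k z)\<bar>)"
        unfolding real_norm_def
        by (intro integral_mono Bochner_Integration.integrable_add int e_meas q_meas) (auto simp: of_bool_def)
      also have "\<dots> = (LINT z|?S. \<bar>of_bool (e i z) - of_bool (q k z)\<bar>) + (LINT z|?S. \<bar>of_bool (e j z) - of_bool (q k z)\<bar>)"
        by (intro Bochner_Integration.integral_add int e_meas q_meas)
      finally show ?thesis using N[OF that(1)] N[OF that(2)] by linarith
    qed
    then show ?thesis by blast
  qed
  have inte: "integrable ?S (\<lambda>z. of_bool (e n z) :: real)" for n
    by (rule unit2.P.integrable_const_bound[where B = 1]) (auto simp: of_bool_def)
  obtain r where r: "strict_mono (r :: nat \<Rightarrow> nat)" and ae: "AE z in ?S. Cauchy (\<lambda>i. of_bool (e (r i) z) :: real)"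
    by (rule cauchy_L1_AE_cauchy_subseq[of ?S "\<lambda>n z. of_bool (e n z) :: real", OF inte cauchy])
  \<comment> \<open>The lower limit instead of a limit chosen almost everywhere: it is measurable,
    symmetric and 0/1-valued at every point.\<close>
  define W where "W x y = (of_bool (\<exists>N. \<forall>i\<ge>N. e (r i) (x, y)) :: real)" for x y
  have lim: "(\<lambda>i. of_bool (e (r i) z) :: real) \<longlonglongrightarrow> W (fst z) (snd z)" if cz: "Cauchy (\<lambda>i. of_bool (e (r i) z) :: real)" for z
  proof -
    \<comment> \<open>For 0/1 values a distance below 1 means equality, so a Cauchy sequence is
      eventually constant.\<close>
    obtain N where N: "\<And>i j. i \<ge> N \<Longrightarrow> j \<ge> N \<Longrightarrow> dist (of_bool (e (r i) z) :: real) (of_bool (e (r j) z)) < 1"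
      using cz unfolding Cauchy_def by (meson zero_less_one)
    have eq: "e (r i) z = e (r j) z" if "i \<ge> N" "j \<ge> N" for i j
      using N[OF that] by (auto simp: of_bool_def split: if_splits)
    have "of_bool (e (r n) z) = W (fst z) (snd z)" if "n \<ge> N" for n
      unfolding W_def using eq[OF that] by (auto simp: of_bool_def) (meson nle_le)+
    then have "\<forall>\<^sub>F i in sequentially. of_bool (e (r i) z) = W (fst z) (snd z)"
      unfolding eventually_sequentially by blast
    then show ?thesis by (rule tendsto_eventually)
  qed
  have W_meas: "(\<lambda>z. W (fst z) (snd z)) \<in> borel_measurable ?S"
    unfolding W_def by simp
  have "graphon W"
    unfolding graphon_def
  proof (intro conjI ballI)
    show "case_prod W \<in> borel_measurable ?S" using W_meas by (simp add: case_prod_unfold)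
    fix x y
    show "W x y \<in> {0..1}" by (simp add: W_def)
    have "e n (x, y) = e n (y, x)" for n
    proof -
      interpret pair_graph "G (s n)" by (rule G)
      show ?thesis unfolding e_def using arcs_symmetric by auto
    qed
    then show "W x y = W y x" by (simp add: W_def)
  qed
  moreover have "random_free W"
  proof -
    have "W x y \<in> {0, 1}" for x y by (auto simp: W_def of_bool_def)
    then show ?thesis unfolding random_free_def case_prod_unfold by (intro AE_I2)
  qed
  moreover have "strict_mono (s \<circ> r)" using s r by (rule strict_mono_o)
  moreover have "converges_to_graphon (G \<circ> (s \<circ> r)) W"
    unfolding converges_to_graphon_def
  proof (intro allI impI)
    fix F :: "nat pair_pre_digraph" assume F: "pair_graph F"
    interpret F: pair_graph F by fact
    let ?A = "{(i, j) \<in> parcs F. i < j}"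
    let ?P = "PiM (pverts F) (\<lambda>_. unit_interval)"
    have finA: "finite ?A" by (rule finite_subset[OF _ F.finite_arcs]) auto
    have A: "i \<in> pverts F \<and> j \<in> pverts F \<and> i \<noteq> j" if "(i, j) \<in> ?A" for i j
      using that F.in_arcsD1 F.in_arcsD2 by auto
    have comp: "(\<lambda>x. h (x i, x j)) \<in> borel_measurable ?P"
      if "(i, j) \<in> ?A" "h \<in> borel_measurable ?S" for i j and h :: "real \<times> real \<Rightarrow> real"
    proof -
      have "i \<in> pverts F" "j \<in> pverts F" using A[OF that(1)] by auto
      then have "(\<lambda>x. (x i, x j)) \<in> measurable ?P ?S" by measurable
      then show ?thesis using that(2) by (rule measurable_compose)
    qed
    have "(\<lambda>n. graphon_density F (pulled_back_graphon (G (s (r n))) (v (s (r n))))) \<longlonglongrightarrow> graphon_density F W"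
      unfolding graphon_density_def
    proof (rule integral_dominated_convergence[where w = "\<lambda>_. 1"])
      show "(\<lambda>x. \<Prod>(i, j)\<in>?A. W (x i) (x j)) \<in> borel_measurable ?P"
        using comp[OF _ W_meas] by (intro borel_measurable_prod) auto
      show "(\<lambda>x. \<Prod>(i, j)\<in>?A. pulled_back_graphon (G (s (r n))) (v (s (r n))) (x i) (x j)) \<in> borel_measurable ?P" for n
      proof -
        have em: "(\<lambda>z. of_bool (e (r n) z) :: real) \<in> borel_measurable ?S" by measurable
        have eq: "pulled_back_graphon (G (s (r n))) (v (s (r n))) x y = of_bool (e (r n) (x, y))" for x y
          by (simp add: pulled_back_graphon_def e_def)
        show ?thesis unfolding eq using comp[OF _ em] by (intro borel_measurable_prod) auto
      qed
      show "integrable ?P (\<lambda>_. 1 :: real)"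
      proof -
        interpret P: prob_space ?P by (rule prob_space_PiM[OF prob_space_unit_interval])
        show ?thesis by simp
      qed
      have "AE x in ?P. \<forall>a\<in>?A. (\<lambda>n. of_bool (e (r n) (x (fst a), x (snd a))) :: real) \<longlonglongrightarrow> W (x (fst a)) (x (snd a))"
      proof (rule AE_finite_allI[OF finA])
        fix a assume "a \<in> ?A"
        moreover have "AE z in ?S. (\<lambda>n. of_bool (e (r n) (fst z, snd z)) :: real) \<longlonglongrightarrow> W (fst z) (snd z)"
          using ae by eventually_elim (simp add: lim)
        ultimately show "AE x in ?P. (\<lambda>n. of_bool (e (r n) (x (fst a), x (snd a))) :: real) \<longlonglongrightarrow> W (x (fst a)) (x (snd a))"
          using A[of "fst a" "snd a"]
          by (intro AE_PiM_pair[where Q = "\<lambda>x y. (\<lambda>n. of_bool (e (r n) (x, y)) :: real) \<longlonglongrightarrow> W x y"]) auto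
      qed
      then show "AE x in ?P. (\<lambda>n. \<Prod>(i, j)\<in>?A. pulled_back_graphon (G (s (r n))) (v (s (r n))) (x i) (x j)) \<longlonglongrightarrow> (\<Prod>(i, j)\<in>?A. W (x i) (x j))"
        by eventually_elim (auto intro!: tendsto_prod simp: pulled_back_graphon_def e_def case_prod_unfold)
      show "AE x in ?P. norm (\<Prod>(i, j)\<in>?A. pulled_back_graphon (G (s (r n))) (v (s (r n))) (x i) (x j)) \<le> 1" for n
        by (intro AE_I2) (auto simp: abs_prod case_prod_unfold pulled_back_graphon_def intro!: prod_le_1)
    qed
    then show "(\<lambda>n. hom_density F ((G \<circ> (s \<circ> r)) n)) \<longlonglongrightarrow> graphon_density F W"
      by (simp add: graphon_density_pulled_back[OF F G v])
  qed
  ultimately show ?thesis by blast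
qed

section \<open>Strongly polynomial sequences\<close>

text \<open>The trivial formula \<open>Equal i i\<close> stands for truth; choosing \<open>i\<close>
  among the variables already present keeps the set of free variables unchanged.\<close>

definition conj_list :: "nat \<Rightarrow> fo_formula list \<Rightarrow> fo_formula" where
  "conj_list i \<phi>s = foldr Conj \<phi>s (Equal i i)"

lemma conj_list_simps:
  "free_vars (conj_list i \<phi>s) = insert i (\<Union>\<phi>\<in>set \<phi>s. free_vars \<phi>)"
  "quantifier_free (conj_list i \<phi>s) \<longleftrightarrow> (\<forall>\<phi>\<in>set \<phi>s. quantifier_free \<phi>)"
  "satisfies G (conj_list i \<phi>s) v \<longleftrightarrow> (\<forall>\<phi>\<in>set \<phi>s. satisfies G \<phi> v)"
  by (induction \<phi>s) (auto simp: conj_list_def)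

lemma strongly_polynomial_conj:
  assumes "strongly_polynomial G" and "finite \<Phi>" and "\<And>\<phi>. \<phi> \<in> \<Phi> \<Longrightarrow> quantifier_free \<phi>"
    and "I = (\<Union>\<phi>\<in>\<Phi>. free_vars \<phi>)" and "I \<noteq> {}"
  shows "\<exists>P :: real poly. \<forall>n. real (card {v \<in> I \<rightarrow>\<^sub>E pverts (G n). \<forall>\<phi>\<in>\<Phi>. satisfies (G n) \<phi> v}) = poly P (real n)"
proof -
  obtain \<phi>s where \<phi>s: "set \<phi>s = \<Phi>" using finite_list[OF assms(2)] by blast
  obtain i where "i \<in> I" using assms(5) by blast
  then have "free_vars (conj_list i \<phi>s) = I"
    using \<phi>s assms(4) by (auto simp: conj_list_simps)
  then have "solutions (conj_list i \<phi>s) (G n) = {v \<in> I \<rightarrow>\<^sub>E pverts (G n). \<forall>\<phi>\<in>\<Phi>. satisfies (G n) \<phi> v}" for n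
    by (simp add: solutions_def conj_list_simps \<phi>s)
  moreover have "quantifier_free (conj_list i \<phi>s)"
    using assms(3) \<phi>s by (simp add: conj_list_simps)
  ultimately show ?thesis
    using assms(1) unfolding strongly_polynomial_def by metis
qed

lemma strongly_polynomial_pattern:
  assumes "strongly_polynomial G" and "2 \<le> m" and "A \<subseteq> index_pairs m"
  shows "\<exists>P :: real poly. \<forall>n. real (card {z \<in> {..<m} \<rightarrow>\<^sub>E pverts (G n).
    pattern (\<lambda>u v. (u, v) \<in> parcs (G n)) m z = A}) = poly P (real n)"
proof -
  define \<Phi> where "\<Phi> = (\<lambda>i. Equal i i) ` {..<m} \<union> (\<lambda>(i, j). Adjacent i j) ` A \<union>
    (\<lambda>(i, j). Neg (Adjacent i j)) ` (index_pairs m - A)"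
  have "finite A" using assms(3) by (rule finite_subset) simp
  then have fin: "finite \<Phi>" by (simp add: \<Phi>_def)
  have I: "{..<m} = (\<Union>\<phi>\<in>\<Phi>. free_vars \<phi>)"
    using assms(3) by (fastforce simp: \<Phi>_def index_pairs_def)
  have ne: "{..<m} \<noteq> {}" using assms(2) by (auto simp: lessThan_empty_iff)
  have qf: "quantifier_free \<phi>" if "\<phi> \<in> \<Phi>" for \<phi>
    using that by (auto simp: \<Phi>_def)
  from strongly_polynomial_conj[OF assms(1) fin qf I ne] obtain P :: "real poly" where
    P: "\<And>n. real (card {v \<in> {..<m} \<rightarrow>\<^sub>E pverts (G n). \<forall>\<phi>\<in>\<Phi>. satisfies (G n) \<phi> v}) = poly P (real n)"
    by blast
  have "(\<forall>\<phi>\<in>\<Phi>. satisfies (G n) \<phi> z) \<longleftrightarrow> pattern (\<lambda>u v. (u, v) \<in> parcs (G n)) m z = A" for n z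
  proof -
    have "(\<forall>\<phi>\<in>\<Phi>. satisfies (G n) \<phi> z) \<longleftrightarrow> (\<forall>(i, j)\<in>A. (z i, z j) \<in> parcs (G n)) \<and>
      (\<forall>(i, j)\<in>index_pairs m - A. (z i, z j) \<notin> parcs (G n))"
      by (simp add: \<Phi>_def ball_Un case_prod_unfold)
    also have "\<dots> \<longleftrightarrow> pattern (\<lambda>u v. (u, v) \<in> parcs (G n)) m z = A"
      using assms(3) unfolding pattern_def by fast
    finally show ?thesis .
  qed
  then show ?thesis using P by (intro exI[of _ P]) simp
qed

section \<open>Vertex counts and homomorphism densities\<close>

lemma strongly_polynomial_card:
  assumes "strongly_polynomial G"
  shows "\<exists>P :: real poly. \<forall>n. real (card (pverts (G n))) = poly P (real n)"
proof -
  have "card (solutions (Equal 0 0) (G n)) = card (pverts (G n))" for n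
    by (simp add: solutions_def card_PiE)
  then show ?thesis
    using assms unfolding strongly_polynomial_def by (metis quantifier_free.simps(1))
qed

lemma strongly_polynomial_homs:
  fixes F :: "nat pair_pre_digraph"
  assumes "strongly_polynomial G" and "pair_graph F" and "pverts F \<noteq> {}"
  shows "\<exists>P :: real poly. \<forall>n. real (card (homs F (G n))) = poly P (real n)"
proof -
  interpret F: pair_graph F by fact
  \<comment> \<open>Isolated vertices of \<open>F\<close> occur in no adjacency atom; the trivial
    identities make them free variables too.\<close>
  define \<Phi> where "\<Phi> = (\<lambda>i. Equal i i) ` pverts F \<union> (\<lambda>(i, j). Adjacent i j) ` parcs F"
  have fin: "finite \<Phi>" by (simp add: \<Phi>_def)
  have I: "pverts F = (\<Union>\<phi>\<in>\<Phi>. free_vars \<phi>)"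
    using F.in_arcsD1 F.in_arcsD2 by (fastforce simp: \<Phi>_def)
  have qf: "quantifier_free \<phi>" if "\<phi> \<in> \<Phi>" for \<phi>
    using that by (auto simp: \<Phi>_def)
  from strongly_polynomial_conj[OF assms(1) fin qf I assms(3)] obtain P :: "real poly" where
    P: "\<And>n. real (card {v \<in> pverts F \<rightarrow>\<^sub>E pverts (G n). \<forall>\<phi>\<in>\<Phi>. satisfies (G n) \<phi> v}) = poly P (real n)"
    by blast
  have "{v \<in> pverts F \<rightarrow>\<^sub>E pverts (G n). \<forall>\<phi>\<in>\<Phi>. satisfies (G n) \<phi> v} = homs F (G n)" for n
    by (auto simp: homs_def \<Phi>_def ball_Un)
  then show ?thesis using P by (intro exI[of _ P]) simp
qed

lemma strongly_polynomial_hom_density_convergent: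
  fixes F :: "nat pair_pre_digraph"
  assumes G: "\<And>n. pair_graph (G n)" and "\<exists>n. pverts (G n) \<noteq> {}"
    and "strongly_polynomial G" and F: "pair_graph F"
  shows "convergent (\<lambda>n. hom_density F (G n))"
proof (cases "pverts F = {}")
  \<comment> \<open>Every formula here has a free variable, so the empty \<open>F\<close> is treated
    separately: it has one homomorphism and density 1.\<close>
  case True
  interpret F: pair_graph F by fact
  have "parcs F = {}" using True F.in_arcsD1 by fastforce
  then have "hom_density F (G n) = 1" for n
    using True by (simp add: hom_density_def homs_def)
  then show ?thesis by (simp add: convergent_const)
next
  case False
  interpret F: pair_graph F by fact
  have finV: "finite (pverts (G n))" for n
  proof -
    interpret pair_graph "G n" by (rule G)
    show ?thesis by auto
  qed
  obtain P where P: "\<And>n. real (card (pverts (G n))) = poly P (real n)"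
    using strongly_polynomial_card[OF assms(3)] by blast
  obtain Q where Q: "\<And>n. real (card (homs F (G n))) = poly Q (real n)"
    using strongly_polynomial_homs[OF assms(3) F False] by blast
  \<comment> \<open>One non-empty graph in the sequence makes the vertex polynomial
    non-zero.\<close>
  have "P \<noteq> 0" using assms(2) P finV by (metis card_0_eq of_nat_eq_0_iff poly_0)
  have "card (homs F (G n)) \<le> card (pverts (G n)) ^ card (pverts F)" for n
  proof -
    have "card (homs F (G n)) \<le> card (pverts F \<rightarrow>\<^sub>E pverts (G n))"
      by (rule card_mono) (auto simp: homs_def finV intro!: finite_PiE)
    then show ?thesis by (simp add: card_PiE)
  qed
  then have "real (card (homs F (G n))) \<le> real (card (pverts (G n))) ^ card (pverts F)" for n
    by (metis of_nat_le_iff of_nat_power)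
  then have "\<bar>poly Q (real n)\<bar> \<le> \<bar>poly (P ^ card (pverts F)) (real n)\<bar>" for n
    using P Q by (metis abs_ge_self abs_of_nat order_trans poly_power)
  then have "convergent (\<lambda>n. poly Q (real n) / poly (P ^ card (pverts F)) (real n))"
    using \<open>P \<noteq> 0\<close> by (intro poly_ratio_convergent) auto
  then show ?thesis by (simp add: hom_density_def P Q)
qed

theorem theorem6p2:
  fixes G :: "nat \<Rightarrow> 'a pair_pre_digraph"
  assumes "\<And>n. pair_graph (G n)"
    and "\<exists>n. pverts (G n) \<noteq> {}"
    and "strongly_polynomial G"
  shows "\<exists>W. graphon W \<and> random_free W \<and> converges_to_graphon G W"
proof -
  have finV: "finite (pverts (G n))" and sym: "symp (\<lambda>u v. (u, v) \<in> parcs (G n))" for n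
  proof -
    interpret pair_graph "G n" by (rule assms(1))
    show "finite (pverts (G n))" by auto
    show "symp (\<lambda>u v. (u, v) \<in> parcs (G n))" using arcs_symmetric by (auto intro: sympI)
  qed
  obtain P where P: "\<And>n. real (card (pverts (G n))) = poly P (real n)"
    using strongly_polynomial_card[OF assms(3)] by blast
  have "P \<noteq> 0" using assms(2) P finV by (metis card_0_eq of_nat_eq_0_iff poly_0)
  then have "\<forall>\<^sub>F n in sequentially. pverts (G n) \<noteq> {}"
    using eventually_poly_nonzero[OF \<open>P \<noteq> 0\<close>] by (auto simp: P[symmetric] elim!: eventually_mono)
  \<comment> \<open>The vertex polynomial has finitely many roots, so discarding finitely many terms
    removes all empty graphs, on which no uniform map exists.\<close>
  then obtain n0 where n0: "\<And>n. n \<ge> n0 \<Longrightarrow> pverts (G n) \<noteq> {}"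
    unfolding eventually_sequentially by blast
  have "\<exists>W s. graphon W \<and> random_free W \<and> strict_mono (s :: nat \<Rightarrow> nat) \<and> converges_to_graphon ((\<lambda>n. G (n + n0)) \<circ> s) W"
  proof (rule labelled_graphs_subseq_converge)
    fix \<epsilon> :: real assume "0 < \<epsilon>"
    have "\<exists>(Lab :: label set) H. finite Lab \<and> (\<forall>\<^sub>F n in sequentially. \<exists>c \<in> pverts (G n) \<rightarrow> Lab.
       real (card {(u, v) \<in> pverts (G n) \<times> pverts (G n). ((u, v) \<in> parcs (G n)) \<noteq> H (c u) (c v)}) \<le> \<epsilon> * (real (card (pverts (G n))))\<^sup>2)"
      by (rule polynomial_patterns_labelling[OF finV sym \<open>P \<noteq> 0\<close> P strongly_polynomial_pattern[OF assms(3)] \<open>0 < \<epsilon>\<close>])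
    then obtain Lab :: "label set" and H where "finite Lab" and ev: "\<forall>\<^sub>F n in sequentially. \<exists>c \<in> pverts (G n) \<rightarrow> Lab.
       real (card {(u, v) \<in> pverts (G n) \<times> pverts (G n). ((u, v) \<in> parcs (G n)) \<noteq> H (c u) (c v)}) \<le> \<epsilon> * (real (card (pverts (G n))))\<^sup>2"
      by (elim exE conjE)
    show "\<exists>(Lab :: label set) H. finite Lab \<and> (\<forall>\<^sub>F n in sequentially. \<exists>c \<in> pverts (G (n + n0)) \<rightarrow> Lab.
       real (card {(u, v) \<in> pverts (G (n + n0)) \<times> pverts (G (n + n0)). ((u, v) \<in> parcs (G (n + n0))) \<noteq> H (c u) (c v)})
         \<le> \<epsilon> * (real (card (pverts (G (n + n0)))))\<^sup>2)"
      by (intro exI conjI, rule \<open>finite Lab\<close>, rule eventually_sequentially_seg[THEN iffD2, OF ev])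
  next
    show "pair_graph (G (n + n0))" for n by (rule assms(1))
    show "pverts (G (n + n0)) \<noteq> {}" for n by (rule n0) simp
  qed
  then obtain W s where W: "graphon W" "random_free W" and s: "strict_mono (s :: nat \<Rightarrow> nat)"
    and conv: "converges_to_graphon ((\<lambda>n. G (n + n0)) \<circ> s) W" by blast
  have "converges_to_graphon G W"
    unfolding converges_to_graphon_def
  proof (intro allI impI)
    fix F :: "nat pair_pre_digraph" assume F: "pair_graph F"
    obtain L where L: "(\<lambda>n. hom_density F (G n)) \<longlonglongrightarrow> L"
      using strongly_polynomial_hom_density_convergent[OF assms F] by (auto simp: convergent_def)
    \<comment> \<open>The full density sequence has a limit already; the subsequence, with indices
      shifted back by \<open>n0\<close>, identifies it.\<close>
    have "strict_mono (\<lambda>n. s n + n0)" using s by (simp add: strict_mono_def)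
    from LIMSEQ_subseq_LIMSEQ[OF L this]
    have "(\<lambda>n. hom_density F (((\<lambda>n. G (n + n0)) \<circ> s) n)) \<longlonglongrightarrow> L" by (simp add: o_def)
    moreover have "(\<lambda>n. hom_density F (((\<lambda>n. G (n + n0)) \<circ> s) n)) \<longlonglongrightarrow> graphon_density F W"
      using conv F unfolding converges_to_graphon_def by blast
    ultimately have "L = graphon_density F W" by (rule LIMSEQ_unique)
    then show "(\<lambda>n. hom_density F (G n)) \<longlonglongrightarrow> graphon_density F W" using L by simp
  qed
  then show ?thesis using W by blast
qed

end
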